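(* Let $X$ be a random variable on $\mathbb{S}^2$ with density $f\in\mathcal{L}^\infty(\mathbb{S}^2)\cap\dot{\mathcal{H}}^s(\mathbb{S}^2)$ for some $s>0$, and let $X_1,\dots,X_n$ be i.i.d. samples of it. Let $h=h_n=n^{-1/(2s+2)}$ and let $g$ be an $s$-admissible symbol. Then for every $\vartheta=(\vartheta_1,\vartheta_2)$, $\varphi=(\varphi_1,\varphi_2)$ with $0\le\vartheta_1<\vartheta_2\le\pi$ and $-\pi\le\varphi_1<\varphi_2\le\pi$, the probability estimator $\widehat{\mathbb{P}}(\mathcal{A}_{\vartheta,\varphi})=\int_{\mathcal{A}_{\vartheta,\varphi}}\widehat f_s\,d\sigma_{\mathbb{S}^2}$ of the region $$\mathcal{A}_{\vartheta,\varphi}=\{x=x(\theta,\phi)\in\mathbb{S}^2:(\theta,\phi)\in[\vartheta_1,\vartheta_2]\times[\varphi_1,\varphi_2]\}$$ satisfies $$\widehat{\mathbb{P}}(\mathcal{A}_{\vartheta,\varphi})=\frac1n\sum_{j=1}^n\sum_{\ell=0}^{N_s}g\Big(h\sqrt{\ell(\ell+1)}\Big)\Big(I_\ell^0(j)+2\sum_{m=1}^\ell I_\ell^m(j)\Big),$$ where, for every $\ell\in\mathbb{N}_0$ and $j=1,\dots,n$, $$I_\ell^0(j)=N_{\ell,0}^2(\varphi_2-\varphi_1)P_\ell(\cos\theta_j)\sum_{k=0}^\ell\binom{\ell}{k}\binom{\ell+k}{k}\Big(\frac{-1}{2}\Big)^k\frac{1}{k+1}\Big((1-\cos\vartheta_2)^{k+1}-(1-\cos\vartheta_1)^{k+1}\Big),$$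 and, for every $\ell\in\mathbb{N}$, $1\le m\le\ell$ and $j=1,\dots,n$, $$I_\ell^m(j)=\frac1m N_{\ell,m}^2P_\ell^m(\cos\theta_j)\Big(\sin\big(m(\varphi_2-\phi_j)\big)-\sin\big(m(\varphi_1-\phi_j)\big)\Big)\sum_{k=m}^\ell\binom{\ell}{k}\binom{\ell+k}{k}\frac{2(-1)^kk!}{(k-m)!}\,\mathcal{B}_{m,k}(\cos\vartheta_2,\cos\vartheta_1).$$ Here $(\theta_j,\phi_j)$ are the spherical coordinates of $X_j$, $j=1,\dots,n$.
   Context: $\mathbb{S}^2=\{x\in\mathbb{R}^3:\|x\|=1\}$ with (unnormalized) surface measure $\sigma_{\mathbb{S}^2}$. Spherical coordinates: $x=x(\theta,\phi)=(\sin\theta\cos\phi,\sin\theta\sin\phi,\cos\theta)$, $(\theta,\phi)\in[0,\pi]\times(-\pi,\pi]$, so that $\int_{\mathbb{S}^2}F\,d\sigma_{\mathbb{S}^2}=\int_{-\pi}^{\pi}\int_0^\pi F(x(\theta,\phi))\sin\theta\,d\theta\,d\phi$ (at the poles one takes $\phi=\pi$). $\langle\cdot,\cdot\rangle$ is the dot product, $\rho_{\mathbb{S}^2}(x,y)=\arccos\langle x,y\rangle$, and $L_{\mathbb{S}^2}$ is the negative of the Laplace–Beltrami operator on $\mathbb{S}^2$, with its usual (spectral) fractional powers. Convention: for $t>0$, $\lfloor t\rfloor$ denotes the largest integer strictly smaller than $t$. Hölder space: $f\in\dot{\mathcal{H}}^s(\mathbb{S}^2)$ means $\sup_{x\ne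 y}|L_{\mathbb{S}^2}^{k/2}f(x)-L_{\mathbb{S}^2}^{k/2}f(y)|/\rho_{\mathbb{S}^2}(x,y)^{s-k}<\infty$, where $k$ is the largest integer strictly less than $s$. $s$-admissible symbol (here $d=2$): an even measurable $g:\mathbb{R}\to\mathbb{R}$ in $\mathcal{C}^\tau(\mathbb{R})$ for some $\tau\in\mathbb{N}$, $\tau>2+s$, with $g(0)=1$, $g^{(\nu)}(0)=0$ for $1\le\nu\le\tau$, and constants $r>\tau+2$, $C_\tau>0$ with $|g^{(\nu)}(\lambda)|\le C_\tau(1+|\lambda|)^{-r}$ for all $\lambda\in\mathbb{R}$, $0\le\nu\le\tau$. Finite-order estimator: with $N_s:=\big\lfloor(2\pi(r-2))^{-\frac1{r-2}}\,n^{\frac{s+r}{(2s+2)(r-2)}}\big\rfloor+1$, $$\widehat f_s(x)=\frac1n\sum_{j=1}^n\sum_{\ell=0}^{N_s}\frac{2\ell+1}{4\pi}g\big(h\sqrt{\ell(\ell+1)}\big)P_\ell(\langle x,X_j\rangle),\quad x\in\mathbb{S}^2.$$ Legendre polynomials: $P_\ell(u)=\frac1{2^\ell\ell!}\frac{d^\ell}{du^\ell}(u^2-1)^\ell$, $\ell\in\mathbb{N}_0$. Associated Legendre functions for $0\le m\le\ell$: $P_\ell^m(u)=(-1)^m(1-u^2)^{m/2}\frac{d^m}{du^m}P_\ell(u)$, $u\in[-1,1]$. Normalization: $N_{\ell,m}=\sqrt{\frac{2\ell+1}{4\pi}}\sqrt{\frac{(\ell-m)!}{(\ell+m)!}}$.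 Incomplete Beta function: for $a,b>0$ and $u\in[0,1]$, $B(u;a,b)=\int_0^ut^{a-1}(1-t)^{b-1}dt$. For integers $1\le m\le k$ and $\gamma_1,\gamma_2\in[-1,1]$, $$\mathcal{B}_{m,k}(\gamma_1,\gamma_2)=B\Big(\frac{1+\gamma_2}{2};\frac m2+1,k-\frac m2+1\Big)-B\Big(\frac{1+\gamma_1}{2};\frac m2+1,k-\frac m2+1\Big).$$ *)

theory Defs
  imports "HOL-Probability.Probability"
begin

section \<open>The sphere\<close>

abbreviation S2 :: "(real ^ 3) set" where
  "S2 \<equiv> sphere 0 1"

definition sph :: "real \<Rightarrow> real \<Rightarrow> real ^ 3" where
  "sph \<theta> \<phi> = vector [sin \<theta> * cos \<phi>, sin \<theta> * sin \<phi>, cos \<theta>]"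

text \<open>At the poles the azimuth is not determined by the point; the convention is
  \<open>\<phi> = \<pi>\<close> there.\<close>

definition is_sph_coords :: "real ^ 3 \<Rightarrow> real \<Rightarrow> real \<Rightarrow> bool" where
  "is_sph_coords x \<theta> \<phi> \<longleftrightarrow>
     \<theta> \<in> {0..pi} \<and> \<phi> \<in> {-pi<..pi} \<and> x = sph \<theta> \<phi> \<and> (\<theta> = 0 \<or> \<theta> = pi \<longrightarrow> \<phi> = pi)"

definition sphere_dist :: "real ^ 3 \<Rightarrow> real ^ 3 \<Rightarrow> real" where
  "sphere_dist x y = arccos (x \<bullet> y)"

text \<open>The unnormalized surface measure, as a measure whose space is the sphere itself: the image
  of \<open>sin \<theta> d\<theta> d\<phi>\<close> under spherical coordinates
  (see \<open>nn_integral_sphere_measure\<close> below).\<close>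

definition sphere_measure :: "(real ^ 3) measure" where
  "sphere_measure =
     distr (density lborel (\<lambda>(\<theta>, \<phi>). ennreal (indicator ({0..pi} \<times> {-pi<..pi}) (\<theta>, \<phi>) * sin \<theta>)))
           (restrict_space borel S2) (\<lambda>(\<theta>, \<phi>). sph \<theta> \<phi>)"

lemma sph_in_S2: "sph \<theta> \<phi> \<in> S2"
proof -
  have "sph \<theta> \<phi> \<bullet> sph \<theta> \<phi> = (sin \<theta>)\<^sup>2 * ((cos \<phi>)\<^sup>2 + (sin \<phi>)\<^sup>2) + (cos \<theta>)\<^sup>2"
    unfolding inner_vec_def sph_def sum_3 vector_3 inner_real_def power2_eq_square by algebra
  also have "\<dots> = 1" by simp
  finally show ?thesis by (simp add: norm_eq_1)
qed

lemma measurable_sph: "(\<lambda>(\<theta>, \<phi>). sph \<theta> \<phi>) \<in> borel \<rightarrow>\<^sub>M restrict_space borel S2"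
proof (rule measurable_restrict_space2)
  have "continuous_on UNIV (\<lambda>p :: real \<times> real. sph (fst p) (snd p) $ i)" for i
  proof -
    consider "i = 1" | "i = 2" | "i = 3" using exhaust_3[of i] by blast
    then show ?thesis
      by cases (simp_all only: sph_def vector_3, (intro continuous_intros)+)
  qed
  then have "continuous_on UNIV (\<lambda>p :: real \<times> real. sph (fst p) (snd p))"
    by (subst continuous_on_componentwise) (auto simp: Basis_vec_def inner_axis)
  then show "(\<lambda>(\<theta>, \<phi>). sph \<theta> \<phi>) \<in> borel \<rightarrow>\<^sub>M borel"
    unfolding case_prod_beta' by (rule borel_measurable_continuous_onI)
  show "(\<lambda>(\<theta>, \<phi>). sph \<theta> \<phi>) \<in> space borel \<rightarrow> S2"
    using sph_in_S2 by fastforce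
qed

lemma nn_integral_sphere_measure:
  assumes "F \<in> borel_measurable sphere_measure"
  shows "(\<integral>\<^sup>+ x. F x \<partial>sphere_measure) =
    (\<integral>\<^sup>+ \<phi>\<in>{-pi<..pi}. (\<integral>\<^sup>+ \<theta>\<in>{0..pi}. F (sph \<theta> \<phi>) * ennreal (sin \<theta>) \<partial>lborel) \<partial>lborel)"
proof -
  let ?D = "\<lambda>(\<theta>, \<phi>). ennreal (indicator ({0..pi} \<times> {-pi<..pi}) (\<theta>, \<phi>) * sin \<theta>)"
  let ?S = "\<lambda>(\<theta>, \<phi>). sph \<theta> \<phi>"
  have sinm: "(\<lambda>p :: real \<times> real. sin (fst p)) \<in> borel_measurable borel"
    by (intro borel_measurable_continuous_onI continuous_intros)
  have rect: "{0..pi} \<times> {-pi<..pi} \<in> sets (borel :: (real \<times> real) measure)"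
    unfolding borel_prod[symmetric] by (intro pair_measureI) auto
  have D: "?D \<in> borel_measurable borel"
    unfolding case_prod_beta' using sinm rect by (intro measurable_compose[OF _ measurable_ennreal] borel_measurable_times) auto
  have F: "F \<in> borel_measurable (restrict_space borel S2)"
    using assms by (simp add: sphere_measure_def)
  have FS: "(\<lambda>p. F (?S p)) \<in> borel_measurable borel"
    using measurable_compose[OF measurable_sph F] .
  have "(\<integral>\<^sup>+ x. F x \<partial>sphere_measure) = (\<integral>\<^sup>+ p. F (?S p) \<partial>density lborel ?D)"
    unfolding sphere_measure_def using measurable_sph F by (intro nn_integral_distr) simp_all
  also have "\<dots> = (\<integral>\<^sup>+ p. ?D p * F (?S p) \<partial>lborel)"
    using D FS by (intro nn_integral_density) simp_all
  also have "\<dots> = (\<integral>\<^sup>+ p. ?D p * F (?S p) \<partial>(lborel \<Otimes>\<^sub>M lborel))"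
    by (simp add: lborel_prod)
  also have "\<dots> = (\<integral>\<^sup>+ \<phi>. (\<integral>\<^sup>+ \<theta>. ?D (\<theta>, \<phi>) * F (?S (\<theta>, \<phi>)) \<partial>lborel) \<partial>lborel)"
  proof (rule lborel_pair.nn_integral_snd[symmetric])
    have "(\<lambda>p. ?D p * F (?S p)) \<in> borel_measurable borel"
      using D FS by (rule borel_measurable_times_ennreal)
    then show "(\<lambda>p. ?D p * F (?S p)) \<in> borel_measurable (lborel \<Otimes>\<^sub>M lborel)"
      by (simp add: lborel_prod)
  qed
  also have "\<dots> = (\<integral>\<^sup>+ \<phi>\<in>{-pi<..pi}. (\<integral>\<^sup>+ \<theta>\<in>{0..pi}. F (sph \<theta> \<phi>) * ennreal (sin \<theta>) \<partial>lborel) \<partial>lborel)"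
    by (intro nn_integral_cong) (auto simp: indicator_def mult.commute intro!: nn_integral_cong)
  finally show ?thesis .
qed

section \<open>The Laplace--Beltrami operator, its fractional powers, and the function spaces\<close>

text \<open>A function on the sphere is extended to a neighbourhood by \<open>y \<mapsto> u (y / \<parallel>y\<parallel>)\<close>, constant
  along rays (\<open>sgn\<close> is the normalization). On the sphere the Euclidean Laplacian of this extension
  is the Laplace--Beltrami operator applied to \<open>u\<close>.\<close>

definition C2_sphere :: "(real ^ 3 \<Rightarrow> real) \<Rightarrow> bool" where
  "C2_sphere u \<longleftrightarrow>
     (\<exists>(D1 :: real ^ 3 \<Rightarrow> (real ^ 3) \<Rightarrow>\<^sub>L real)
       (D2 :: real ^ 3 \<Rightarrow> (real ^ 3) \<Rightarrow>\<^sub>L (real ^ 3) \<Rightarrow>\<^sub>L real).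
        (\<forall>y. y \<noteq> 0 \<longrightarrow>
           ((\<lambda>z. u (sgn z)) has_derivative blinfun_apply (D1 y)) (at y) \<and>
           (D1 has_derivative blinfun_apply (D2 y)) (at y)) \<and>
        continuous_on (- {0}) D2)"

definition neg_laplace_beltrami :: "(real ^ 3 \<Rightarrow> real) \<Rightarrow> real ^ 3 \<Rightarrow> real" where
  "neg_laplace_beltrami u x =
     - (\<Sum>b\<in>Basis. (deriv ^^ 2) (\<lambda>t. u (sgn (x + t *\<^sub>R b))) 0)"

definition L2_sphere :: "(real ^ 3 \<Rightarrow> real) set" where
  "L2_sphere = {f. f \<in> borel_measurable sphere_measure \<and> integrable sphere_measure (\<lambda>x. (f x)\<^sup>2)}"

definition Linf_sphere :: "(real ^ 3 \<Rightarrow> real) set" where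
  "Linf_sphere = {f. f \<in> borel_measurable sphere_measure \<and>
     (\<exists>C. AE x in sphere_measure. \<bar>f x\<bar> \<le> C)}"

definition L2_inner :: "(real ^ 3 \<Rightarrow> real) \<Rightarrow> (real ^ 3 \<Rightarrow> real) \<Rightarrow> real" where
  "L2_inner f g = (LINT x|sphere_measure. f x * g x)"

text \<open>\<open>u\<close> is an orthonormal basis of \<open>L\<^sup>2\<close> consisting of eigenfunctions of the negative
  Laplace--Beltrami operator, with eigenvalues \<open>\<mu>\<close>.\<close>

definition eigenbasis :: "(nat \<Rightarrow> real ^ 3 \<Rightarrow> real) \<Rightarrow> (nat \<Rightarrow> real) \<Rightarrow> bool" where
  "eigenbasis u \<mu> \<longleftrightarrow>
     (\<forall>i. u i \<in> L2_sphere \<and> C2_sphere (u i) \<and>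
          (\<forall>x\<in>S2. neg_laplace_beltrami (u i) x = \<mu> i * u i x)) \<and>
     (\<forall>i j. L2_inner (u i) (u j) = (if i = j then 1 else 0)) \<and>
     (\<forall>f\<in>L2_sphere. (\<forall>i. L2_inner f (u i) = 0) \<longrightarrow> (AE x in sphere_measure. f x = 0))"

text \<open>\<open>F\<close> is a representative of the \<open>L\<^sup>2\<close> class
  \<open>L\<^sup>k\<^sup>/\<^sup>2 f = \<Sum>\<^sub>i \<mu>\<^sub>i\<^sup>k\<^sup>/\<^sup>2 \<langle>f, u\<^sub>i\<rangle> u\<^sub>i\<close>, the series converging in \<open>L\<^sup>2\<close>.
  Writing the factor as \<open>(sqrt \<mu>)^k\<close> gives it the value 1 for \<open>k = 0\<close> also at the eigenvalue 0
  (\<open>0 powr 0\<close> is 0), so that the power of exponent 0 is the identity.\<close>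

definition is_half_power :: "nat \<Rightarrow> (real ^ 3 \<Rightarrow> real) \<Rightarrow> (real ^ 3 \<Rightarrow> real) \<Rightarrow> bool" where
  "is_half_power k f F \<longleftrightarrow> f \<in> L2_sphere \<and> F \<in> L2_sphere \<and>
     (\<exists>u \<mu>. eigenbasis u \<mu> \<and>
        (\<lambda>N. LINT x|sphere_measure. (F x - (\<Sum>i<N. sqrt (\<mu> i) ^ k * L2_inner f (u i) * u i x))\<^sup>2)
          \<longlonglongrightarrow> 0)"

definition strict_floor :: "real \<Rightarrow> int" where
  "strict_floor t = (GREATEST k. of_int k < t)"

lemma strict_floor_eq: "strict_floor t = \<lceil>t\<rceil> - 1"
  unfolding strict_floor_def by (rule Greatest_equality) linarith+

definition holder_sphere :: "real \<Rightarrow> (real ^ 3 \<Rightarrow> real) set" where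
  "holder_sphere s = {f. \<exists>F. is_half_power (nat (strict_floor s)) f F \<and>
     bdd_above {\<bar>F x - F y\<bar> / sphere_dist x y powr (s - of_int (strict_floor s)) | x y.
                  x \<in> S2 \<and> y \<in> S2 \<and> x \<noteq> y}}"

section \<open>The estimator\<close>

text \<open>The decay exponent \<open>r\<close> is a parameter because it enters the truncation order below.\<close>

definition admissible :: "real \<Rightarrow> real \<Rightarrow> (real \<Rightarrow> real) \<Rightarrow> bool" where
  "admissible s r g \<longleftrightarrow>
     g \<in> borel_measurable borel \<and> (\<forall>t. g (- t) = g t) \<and>
     (\<exists>\<tau> :: nat. real \<tau> > 2 + s \<and> r > real \<tau> + 2 \<and>
        (\<forall>\<nu><\<tau>. (deriv ^^ \<nu>) g differentiable_on UNIV) \<and>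
        continuous_on UNIV ((deriv ^^ \<tau>) g) \<and>
        g 0 = 1 \<and> (\<forall>\<nu>\<in>{1..\<tau>}. (deriv ^^ \<nu>) g 0 = 0) \<and>
        (\<exists>C>0. \<forall>t. \<forall>\<nu>\<le>\<tau>. \<bar>(deriv ^^ \<nu>) g t\<bar> \<le> C * (1 + \<bar>t\<bar>) powr (- r)))"

definition legendre_P :: "nat \<Rightarrow> real \<Rightarrow> real" where
  "legendre_P l u = 1 / (2 ^ l * fact l) * (deriv ^^ l) (\<lambda>v. (v\<^sup>2 - 1) ^ l) u"

definition assoc_legendre :: "nat \<Rightarrow> nat \<Rightarrow> real \<Rightarrow> real" where
  "assoc_legendre l m u = (- 1) ^ m * sqrt (1 - u\<^sup>2) ^ m * (deriv ^^ m) (legendre_P l) u"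

definition N_norm :: "nat \<Rightarrow> nat \<Rightarrow> real" where
  "N_norm l m = sqrt ((2 * real l + 1) / (4 * pi)) * sqrt (fact (l - m) / fact (l + m))"

definition N_trunc :: "real \<Rightarrow> real \<Rightarrow> nat \<Rightarrow> nat" where
  "N_trunc s r n =
     nat (strict_floor ((2 * pi * (r - 2)) powr (- (1 / (r - 2))) *
                        real n powr ((s + r) / ((2 * s + 2) * (r - 2)))) + 1)"

text \<open>The sample is \<open>Y 1, \<dots>, Y n\<close>.\<close>

definition f_hat :: "real \<Rightarrow> real \<Rightarrow> (real \<Rightarrow> real) \<Rightarrow> real \<Rightarrow> nat \<Rightarrow> (nat \<Rightarrow> real ^ 3) \<Rightarrow> real ^ 3 \<Rightarrow> real" where
  "f_hat s r g h n Y x =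
     1 / real n * (\<Sum>j=1..n. \<Sum>l=0..N_trunc s r n.
       (2 * real l + 1) / (4 * pi) * g (h * sqrt (real l * (real l + 1))) * legendre_P l (x \<bullet> Y j))"

definition region :: "real \<Rightarrow> real \<Rightarrow> real \<Rightarrow> real \<Rightarrow> (real ^ 3) set" where
  "region \<theta>1 \<theta>2 \<phi>1 \<phi>2 = (\<lambda>(\<theta>, \<phi>). sph \<theta> \<phi>) ` ({\<theta>1..\<theta>2} \<times> {\<phi>1..\<phi>2})"

definition P_hat :: "real \<Rightarrow> real \<Rightarrow> (real \<Rightarrow> real) \<Rightarrow> real \<Rightarrow> nat \<Rightarrow> (nat \<Rightarrow> real ^ 3) \<Rightarrow> (real ^ 3) set \<Rightarrow> real" where
  "P_hat s r g h n Y A = (LINT x:A|sphere_measure. f_hat s r g h n Y x)"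

section \<open>The closed form\<close>

definition inc_beta :: "real \<Rightarrow> real \<Rightarrow> real \<Rightarrow> real" where
  "inc_beta u a b = integral {0..u} (\<lambda>t. t powr (a - 1) * (1 - t) powr (b - 1))"

definition B_diff :: "nat \<Rightarrow> nat \<Rightarrow> real \<Rightarrow> real \<Rightarrow> real" where
  "B_diff m k \<gamma>1 \<gamma>2 =
     inc_beta ((1 + \<gamma>2) / 2) (real m / 2 + 1) (real k - real m / 2 + 1) -
     inc_beta ((1 + \<gamma>1) / 2) (real m / 2 + 1) (real k - real m / 2 + 1)"

text \<open>In the next two definitions \<open>\<theta>1 \<theta>2 \<phi>1 \<phi>2\<close> bound the region, and \<open>\<theta>, \<phi>\<close> are the
  spherical coordinates of a sample point.\<close>

definition I_zero :: "real \<Rightarrow> real \<Rightarrow> real \<Rightarrow> real \<Rightarrow> nat \<Rightarrow> real \<Rightarrow> real" where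
  "I_zero \<theta>1 \<theta>2 \<phi>1 \<phi>2 l \<theta> =
     (N_norm l 0)\<^sup>2 * (\<phi>2 - \<phi>1) * legendre_P l (cos \<theta>) *
     (\<Sum>k=0..l. real (l choose k) * real ((l + k) choose k) * (- 1 / 2) ^ k * (1 / (real k + 1)) *
        ((1 - cos \<theta>2) ^ (k + 1) - (1 - cos \<theta>1) ^ (k + 1)))"

definition I_pos :: "real \<Rightarrow> real \<Rightarrow> real \<Rightarrow> real \<Rightarrow> nat \<Rightarrow> nat \<Rightarrow> real \<Rightarrow> real \<Rightarrow> real" where
  "I_pos \<theta>1 \<theta>2 \<phi>1 \<phi>2 l m \<theta> \<phi> =
     1 / real m * (N_norm l m)\<^sup>2 * assoc_legendre l m (cos \<theta>) *
     (sin (real m * (\<phi>2 - \<phi>)) - sin (real m * (\<phi>1 - \<phi>))) *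
     (\<Sum>k=m..l. real (l choose k) * real ((l + k) choose k) * (2 * (- 1) ^ k * fact k / fact (k - m)) *
        B_diff m k (cos \<theta>2) (cos \<theta>1))"

end

theory Submission
  imports Defs
begin

text \<open>The estimator is a finite sum of zonal functions \<open>P\<^sub>\<ell>(\<langle>x, X\<^sub>j\<rangle>)\<close>, so everything reduces to integrating one
  of them over a coordinate rectangle. The coordinates of \<open>x\<close> are coupled in
  \<open>\<langle>x, X\<^sub>j\<rangle> = cos \<theta> cos \<theta>\<^sub>j + sin \<theta> sin \<theta>\<^sub>j cos (\<phi> - \<phi>\<^sub>j)\<close>; the addition theorem \<open>legendre_addition\<close>
  separates them: \<open>P\<^sub>\<ell>\<close> of this quantity is a cosine sum in \<open>\<phi> - \<phi>\<^sub>j\<close> whose \<open>m\<close>-th coefficient is, up to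
  a constant factor, \<open>P\<^sub>\<ell>\<^sup>m(cos \<theta>) P\<^sub>\<ell>\<^sup>m(cos \<theta>\<^sub>j)\<close>. The azimuthal integral is then elementary and produces the
  sine differences. For the polar integral, \<open>P\<^sub>\<ell>\<^sup>m\<close> is written as \<open>(1 - u\<^sup>2)\<^bsup>m/2\<^esup>\<close> times a
  polynomial in \<open>u - 1\<close>, where \<open>u = cos \<theta>\<close>. For \<open>m = 0\<close> the powers are integrated directly; for \<open>m > 0\<close>, with
  \<open>t = (1 + cos \<theta>) / 2\<close> each summand becomes \<open>t\<^sup>p (1 - t)\<^sup>q\<close> with \<open>p = m/2\<close> and \<open>q = k - m/2\<close>,
  whose primitive is an incomplete Beta function (\<open>has_integral_assoc_legendre_cos\<close>).

  The addition theorem is proved by induction on \<open>\<ell>\<close> from the three-term recurrence: the claimed cosine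
  coefficients satisfy the recurrence that the three-term recurrence induces, because \<open>u D\<^sub>\<ell>\<^sup>m\<close>, \<open>D\<^sub>\<ell>\<^sup>m\<close> and
  \<open>(1 - u\<^sup>2) D\<^sub>\<ell>\<^sup>m\<close>, where \<open>D\<^sub>\<ell>\<^sup>m\<close> is the \<open>m\<close>-th derivative of \<open>P\<^sub>\<ell>\<close>, are all combinations of derivatives
  of \<open>P\<close> with index \<open>\<ell> \<plusminus> 1\<close>. All these relations come from the two identities \<open>W\<^sub>\<ell>\<^sub>+\<^sub>1' = x W\<^sub>\<ell>\<close> and
  \<open>W\<^sub>\<ell>\<^sub>+\<^sub>2'' = (2\<ell> + 3) W\<^sub>\<ell>\<^sub>+\<^sub>1 + W\<^sub>\<ell>\<close> for \<open>W\<^sub>\<ell> = (x\<^sup>2 - 1)\<^sup>\<ell> / (2\<^sup>\<ell> \<ell>!)\<close>, the polynomial in the Rodrigues formula.\<close>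

section \<open>Legendre polynomials and their derivatives\<close>

definition rodrigues_poly :: "nat \<Rightarrow> real poly" where
  "rodrigues_poly l = smult (1 / (2 ^ l * fact l)) ([:- 1, 0, 1:] ^ l)"

text \<open>By the Rodrigues formula the first \<open>l\<close> derivatives produce the Legendre polynomial \<open>P\<^sub>l\<close>; the other \<open>m\<close>
  differentiate it.\<close>

definition legendre_deriv :: "nat \<Rightarrow> nat \<Rightarrow> real poly" where
  "legendre_deriv m l = (pderiv ^^ (l + m)) (rodrigues_poly l)"

lemma deriv_poly: "deriv (poly p) = poly (pderiv p)" for p :: "real poly"
  by (rule ext, rule DERIV_imp_deriv, rule poly_DERIV)

lemma higher_deriv_poly: "(deriv ^^ n) (poly p) = poly ((pderiv ^^ n) p)" for p :: "real poly"
  by (induction n) (simp_all add: deriv_poly)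

lemma higher_pderiv_smult: "(pderiv ^^ n) (smult c p) = smult c ((pderiv ^^ n) p)" for p :: "real poly"
  by (induction n) (simp_all add: pderiv_smult)

lemma higher_pderiv_add: "(pderiv ^^ n) (p + q) = (pderiv ^^ n) p + (pderiv ^^ n) q" for p q :: "real poly"
  by (induction n) (simp_all add: pderiv_add)

lemma higher_pderiv_0: "(pderiv ^^ n) (0 :: real poly) = 0"
  by (induction n) simp_all

lemma higher_pderiv_sum: "(pderiv ^^ n) (\<Sum>i\<in>A. p i) = (\<Sum>i\<in>A. (pderiv ^^ n) (p i))"
  for p :: "'b \<Rightarrow> real poly"
proof (induction A rule: infinite_finite_induct)
  case (insert a A)
  then show ?case by (simp add: higher_pderiv_add)
qed (simp_all add: higher_pderiv_0)

lemma higher_pderiv_times_x: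
  "(pderiv ^^ Suc n) ([:0, 1:] * p) =
     [:0, 1:] * (pderiv ^^ Suc n) p + of_nat (Suc n) * (pderiv ^^ n) p" for p :: "real poly"
proof (induction n)
  case 0
  then show ?case by (simp add: pderiv_mult pderiv_pCons)
next
  case (Suc n)
  have "(pderiv ^^ Suc (Suc n)) ([:0, 1:] * p) = pderiv ((pderiv ^^ Suc n) ([:0, 1:] * p))" by simp
  also have "\<dots> = pderiv ([:0, 1:] * (pderiv ^^ Suc n) p + of_nat (Suc n) * (pderiv ^^ n) p)"
    by (simp only: Suc.IH)
  also have "\<dots> = [:0, 1:] * (pderiv ^^ Suc (Suc n)) p + of_nat (Suc (Suc n)) * (pderiv ^^ Suc n) p"
    unfolding pderiv_add pderiv_mult pderiv_of_nat
    by (simp add: pderiv_pCons algebra_simps)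
  finally show ?case .
qed

lemma legendre_P_eq_poly: "legendre_P l = poly (legendre_deriv 0 l)"
proof -
  have *: "(\<lambda>v. (v\<^sup>2 - 1) ^ l) = poly ([:- 1, 0, 1 :: real:] ^ l)"
    by (rule ext) (simp add: power2_eq_square algebra_simps)
  show ?thesis
    by (rule ext) (simp add: legendre_P_def * higher_deriv_poly legendre_deriv_def
      rodrigues_poly_def higher_pderiv_smult del: poly_power)
qed

lemma higher_deriv_legendre_P: "(deriv ^^ m) (legendre_P l) = poly (legendre_deriv m l)"
  by (simp add: legendre_P_eq_poly higher_deriv_poly legendre_deriv_def add.commute[of l] funpow_add o_def)

lemma pderiv_legendre_deriv: "pderiv (legendre_deriv m l) = legendre_deriv (Suc m) l"
  by (simp add: legendre_deriv_def)

lemma legendre_deriv_0_0: "legendre_deriv 0 0 = 1"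
  by (simp add: legendre_deriv_def rodrigues_poly_def)

lemma higher_pderiv_eq_0:
  assumes "degree p < n"
  shows "(pderiv ^^ n) (p :: real poly) = 0"
  using assms
proof (induction n arbitrary: p)
  case (Suc n)
  show ?case
  proof (cases "degree p = 0")
    case True
    then have "pderiv p = 0" by (simp add: pderiv_eq_0_iff)
    then show ?thesis by (simp add: funpow_swap1 higher_pderiv_0)
  next
    case False
    then show ?thesis using Suc.IH[of "pderiv p"] Suc.prems by (simp add: funpow_swap1 degree_pderiv)
  qed
qed simp

lemma legendre_deriv_eq_0:
  assumes "l < m"
  shows "legendre_deriv m l = 0"
proof -
  have "degree (rodrigues_poly l) \<le> 2 * l"
    unfolding rodrigues_poly_def
    by (rule order.trans[OF degree_smult_le], rule order.trans[OF degree_power_le]) simp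
  then show ?thesis
    unfolding legendre_deriv_def using assms by (intro higher_pderiv_eq_0) simp
qed

lemma pderiv_rodrigues_Suc: "pderiv (rodrigues_poly (Suc l)) = [:0, 1:] * rodrigues_poly l"
proof -
  have "pderiv ([:-1, 0, 1 :: real:] ^ Suc l) = smult (2 * (1 + real l)) ([:0, 1:] * [:-1, 0, 1:] ^ l)"
    by (simp add: pderiv_power_Suc pderiv_pCons algebra_simps smult_smult flip: smult_add_left del: power_Suc)
  moreover have "1 / (2 ^ Suc l * fact (Suc l)) * (2 * (1 + real l)) = 1 / (2 ^ l * fact l)"
    by (simp add: divide_simps del: of_nat_Suc) (simp add: algebra_simps)
  ultimately show ?thesis
    unfolding rodrigues_poly_def pderiv_smult by (simp only: smult_smult mult_smult_right)
qed

text \<open>With \<open>W\<close> and \<open>V\<close> the polynomials of index \<open>l + 1\<close> and \<open>l\<close>, the first derivative is \<open>x W\<close>, so the second is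
  \<open>W + x\<^sup>2 V\<close>, and
  \<open>x\<^sup>2 V = (x\<^sup>2 - 1) V + V\<close>, where \<open>(x\<^sup>2 - 1) V\<close> is again a multiple of \<open>W\<close>.\<close>

lemma pderiv2_rodrigues_Suc_Suc:
  "(pderiv ^^ 2) (rodrigues_poly (Suc (Suc l))) =
     smult (2 * real l + 3) (rodrigues_poly (Suc l)) + rodrigues_poly l"
proof -
  have "(pderiv ^^ 2) (rodrigues_poly (Suc (Suc l))) = pderiv ([:0, 1:] * rodrigues_poly (Suc l))"
    by (simp add: numeral_2_eq_2 pderiv_rodrigues_Suc)
  also have "\<dots> = rodrigues_poly (Suc l) + [:0, 1:] * ([:0, 1:] * rodrigues_poly l)"
    unfolding pderiv_mult pderiv_rodrigues_Suc by (simp add: pderiv_pCons)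
  also have "[:0, 1:] * ([:0, 1:] * rodrigues_poly l) =
      [:-1, 0, 1:] * rodrigues_poly l + rodrigues_poly l"
    by (simp add: algebra_simps)
  also have "[:-1, 0, 1:] * rodrigues_poly l = smult (2 * real (Suc l)) (rodrigues_poly (Suc l))"
  proof -
    have "2 * real (Suc l) * (1 / (2 ^ Suc l * fact (Suc l))) = 1 / (2 ^ l * fact l)"
      by (simp add: divide_simps del: of_nat_Suc)
    then show ?thesis
      unfolding rodrigues_poly_def by (simp only: smult_smult mult_smult_right power_Suc)
  qed
  finally have "(pderiv ^^ 2) (rodrigues_poly (Suc (Suc l))) =
    rodrigues_poly (Suc l) + (smult (2 * real (Suc l)) (rodrigues_poly (Suc l)) + rodrigues_poly l)" .
  moreover have "p + smult (2 * real (Suc l)) p = smult (2 * real l + 3) p" for p :: "real poly"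
    by (rule poly_eqI) (simp add: algebra_simps)
  ultimately show ?thesis by (simp only: add.assoc[symmetric])
qed

text \<open>The second-derivative identity, differentiated \<open>l + 1 + m\<close> times. Read from right to left it trades a
  derivative of order \<open>m\<close> for two of order \<open>m + 1\<close>.\<close>

lemma legendre_deriv_raise:
  "legendre_deriv (Suc m) (Suc (Suc l)) = smult (2 * real l + 3) (legendre_deriv m (Suc l)) + legendre_deriv (Suc m) l"
proof -
  have "legendre_deriv (Suc m) (Suc (Suc l)) = (pderiv ^^ (Suc l + m)) ((pderiv ^^ 2) (rodrigues_poly (Suc (Suc l))))"
    by (simp add: legendre_deriv_def numeral_2_eq_2 funpow_swap1)
  then show ?thesis
    by (simp only: pderiv2_rodrigues_Suc_Suc higher_pderiv_add higher_pderiv_smult legendre_deriv_def add_Suc add_Suc_right)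
qed

text \<open>Two expressions for \<open>P\<^sub>l\<^sub>+\<^sub>2\<close> in terms of the same polynomial \<open>Z\<close>, the \<open>l\<close>-th derivative of \<open>W\<^sub>l\<^sub>+\<^sub>1\<close>: one
  from the second-derivative identity, one from the Leibniz rule applied to \<open>x W\<^sub>l\<^sub>+\<^sub>1\<close>. Eliminating \<open>Z\<close>
  leaves Bonnet's recurrence.\<close>

lemma legendre_three_term:
  "of_nat (l + 2) * legendre_deriv 0 (Suc (Suc l)) =
     of_nat (2 * l + 3) * ([:0, 1:] * legendre_deriv 0 (Suc l)) - of_nat (l + 1) * legendre_deriv 0 l"
proof -
  define Z where "Z = (pderiv ^^ l) (rodrigues_poly (Suc l))"
  have "legendre_deriv 0 (Suc (Suc l)) = (pderiv ^^ l) ((pderiv ^^ 2) (rodrigues_poly (Suc (Suc l))))"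
    by (simp add: legendre_deriv_def numeral_2_eq_2 funpow_swap1)
  then have 1: "legendre_deriv 0 (Suc (Suc l)) = of_nat (2 * l + 3) * Z + legendre_deriv 0 l"
    by (simp add: pderiv2_rodrigues_Suc_Suc higher_pderiv_add higher_pderiv_smult legendre_deriv_def Z_def of_nat_poly)
  have "legendre_deriv 0 (Suc (Suc l)) = (pderiv ^^ Suc l) (pderiv (rodrigues_poly (Suc (Suc l))))"
    by (simp add: legendre_deriv_def funpow_swap1)
  then have 2: "legendre_deriv 0 (Suc (Suc l)) = [:0, 1:] * legendre_deriv 0 (Suc l) + of_nat (Suc l) * Z"
    unfolding pderiv_rodrigues_Suc higher_pderiv_times_x by (simp add: legendre_deriv_def Z_def)
  show ?thesis using 1 2 unfolding of_nat_add of_nat_mult of_nat_Suc of_nat_numeral of_nat_1 by algebra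
qed

text \<open>The Leibniz rule for \<open>l + 1\<close> derivatives of \<open>x W\<^sub>l\<close>, which is the derivative of \<open>W\<^sub>l\<^sub>+\<^sub>1\<close>.\<close>

lemma legendre_ladder:
  "legendre_deriv 1 (Suc l) = [:0, 1:] * legendre_deriv 1 l + of_nat (Suc l) * legendre_deriv 0 l"
proof -
  have "legendre_deriv 1 (Suc l) = (pderiv ^^ Suc l) (pderiv (rodrigues_poly (Suc l)))"
    by (simp add: legendre_deriv_def funpow_swap1)
  then show ?thesis unfolding pderiv_rodrigues_Suc higher_pderiv_times_x by (simp add: legendre_deriv_def)
qed

text \<open>Bonnet's recurrence differentiated \<open>m\<close> times; the lower derivatives of \<open>P\<^sub>l\<^sub>+\<^sub>1\<close> that the Leibniz rule
  creates are removed with \<open>legendre_deriv_raise\<close>.\<close>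

lemma legendre_deriv_times_x:
  "of_nat (2 * l + 3) * ([:0, 1:] * legendre_deriv m (Suc l)) =
     (of_nat (l + 2) - of_nat m) * legendre_deriv m (Suc (Suc l)) + of_nat (l + 1 + m) * legendre_deriv m l"
proof (induction m)
  case 0
  show ?case using legendre_three_term[of l] by (simp add: algebra_simps)
next
  case (Suc m)
  from arg_cong[OF Suc.IH, of pderiv]
  have "of_nat (2 * l + 3) * ([:0, 1:] * legendre_deriv (Suc m) (Suc l) + legendre_deriv m (Suc l)) =
     (of_nat (l + 2) - of_nat m) * legendre_deriv (Suc m) (Suc (Suc l)) + of_nat (l + 1 + m) * legendre_deriv (Suc m) l"
    by (simp only: pderiv_mult pderiv_add pderiv_diff pderiv_of_nat pderiv_legendre_deriv pderiv_pCons) (simp add: algebra_simps)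
  moreover have "legendre_deriv (Suc m) (Suc (Suc l)) = of_nat (2 * l + 3) * legendre_deriv m (Suc l) + legendre_deriv (Suc m) l"
    by (simp add: legendre_deriv_raise of_nat_poly)
  ultimately show ?case unfolding of_nat_add of_nat_mult of_nat_Suc of_nat_numeral of_nat_1 by algebra
qed

text \<open>Counterpart of \<open>legendre_deriv_raise\<close>: with the factor \<open>1 - x\<^sup>2\<close> a derivative can be traded for one of
  order one less. Differentiating the case \<open>m\<close> yields the case \<open>m + 1\<close> once the term \<open>-2x\<close> from the factor
  is rewritten by \<open>legendre_deriv_times_x\<close>.\<close>

lemma legendre_deriv_lower:
  "of_nat (2 * l + 3) * ((1 - [:0, 1:] * [:0, 1:]) * legendre_deriv (Suc m) (Suc l)) =
     of_nat ((l + 1 + m) * (l + 2 + m)) * legendre_deriv m l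
     - (of_nat (l + 1) - of_nat m) * (of_nat (l + 2) - of_nat m) * legendre_deriv m (Suc (Suc l))"
proof (induction m)
  case 0
  define x D1 D0 E1 E0 F0 n where *: "x = [:0, 1 :: real:]" "D1 = legendre_deriv 1 (Suc l)"
    "D0 = legendre_deriv 0 (Suc l)" "E1 = legendre_deriv 1 l" "E0 = legendre_deriv 0 l"
    "F0 = legendre_deriv 0 (Suc (Suc l))" "n = (of_nat l :: real poly)"
  have a: "D1 = x * E1 + (n + 1) * E0"
    using legendre_ladder[of l] by (simp add: * algebra_simps)
  have b: "x * D1 = E1 + (n + 1) * D0"
  proof -
    define X where "X = legendre_deriv 1 (Suc (Suc l))"
    have "X = x * D1 + (n + 2) * D0"
      using legendre_ladder[of "Suc l"] by (simp add: * X_def algebra_simps)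
    moreover have "X = (2 * n + 3) * D0 + E1"
      using legendre_deriv_raise[of 0 l] by (simp add: * X_def of_nat_poly numeral_poly add.commute mult.commute[of 2])
    ultimately show ?thesis by algebra
  qed
  have c: "(n + 2) * F0 = (2 * n + 3) * (x * D0) - (n + 1) * E0"
    using legendre_three_term[of l] by (simp add: * algebra_simps)
  have "(2 * n + 3) * ((1 - x * x) * D1) = (n + 1) * (n + 2) * E0 - (n + 1) * (n + 2) * F0"
    using a b c by algebra
  then show ?case by (simp add: * algebra_simps)
next
  case (Suc m)
  define x where "x = [:0, 1 :: real:]"
  have x: "pderiv x = 1" by (simp add: x_def pderiv_pCons one_pCons)
  from arg_cong[OF Suc.IH[folded x_def], of pderiv]
  have "of_nat (2 * l + 3) * ((1 - x * x) * legendre_deriv (Suc (Suc m)) (Suc l)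
      - 2 * x * legendre_deriv (Suc m) (Suc l)) =
     of_nat ((l + 1 + m) * (l + 2 + m)) * legendre_deriv (Suc m) l
     - (of_nat (l + 1) - of_nat m) * (of_nat (l + 2) - of_nat m) * legendre_deriv (Suc m) (Suc (Suc l))"
    unfolding pderiv_mult pderiv_add pderiv_diff pderiv_of_nat pderiv_legendre_deriv x pderiv_1
    by (simp add: algebra_simps)
  with legendre_deriv_times_x[of l "Suc m", folded x_def] show ?case
    unfolding of_nat_add of_nat_mult of_nat_Suc of_nat_numeral of_nat_1 x_def[symmetric] by algebra
qed

section \<open>The addition theorem\<close>

lemma poly_legendre_deriv_times_x:
  "(2 * real l + 3) * (x * poly (legendre_deriv m (Suc l)) x) =
     (real l + 2 - real m) * poly (legendre_deriv m (Suc (Suc l))) x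
     + (real l + 1 + real m) * poly (legendre_deriv m l) x"
  using arg_cong[OF legendre_deriv_times_x[of l m], of "\<lambda>p. poly p x"] by (simp add: algebra_simps)

lemma poly_legendre_deriv_raise:
  "(2 * real l + 3) * poly (legendre_deriv m (Suc l)) x =
     poly (legendre_deriv (Suc m) (Suc (Suc l))) x - poly (legendre_deriv (Suc m) l) x"
  using arg_cong[OF legendre_deriv_raise[of m l], of "\<lambda>p. poly p x"] by (simp add: algebra_simps)

lemma poly_legendre_deriv_lower:
  "(2 * real l + 3) * ((1 - x\<^sup>2) * poly (legendre_deriv (Suc m) (Suc l)) x) =
     (real l + 1 + real m) * (real l + 2 + real m) * poly (legendre_deriv m l) x
     - (real l + 1 - real m) * (real l + 2 - real m) * poly (legendre_deriv m (Suc (Suc l))) x"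
  using arg_cong[OF legendre_deriv_lower[of l m], of "\<lambda>p. poly p x"]
  by (simp add: algebra_simps power2_eq_square)

text \<open>Half the \<open>m\<close>-th cosine coefficient of the addition theorem (the whole one for \<open>m = 0\<close>), with
  \<open>u = cos \<theta>\<close>, \<open>v = cos \<theta>'\<close> and \<open>q = sin \<theta> sin \<theta>'\<close>. Keeping \<open>q\<close> as a variable constrained only through \<open>q\<^sup>2\<close>
  makes the recurrences below free of square roots.\<close>

definition addition_coeff :: "real \<Rightarrow> real \<Rightarrow> real \<Rightarrow> nat \<Rightarrow> nat \<Rightarrow> real" where
  "addition_coeff u v q l m = fact (l - m) / fact (l + m) * q ^ m *
     (poly (legendre_deriv m l) u * poly (legendre_deriv m l) v)"

lemma addition_coeff_eq_0: "l < m \<Longrightarrow> addition_coeff u v q l m = 0"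
  by (simp add: addition_coeff_def legendre_deriv_eq_0)

text \<open>The recurrence that multiplication by \<open>u v + q cos t\<close> forces on the constant term: \<open>cos t\<close> moves the
  first harmonic down to the constant. The factors \<open>u v\<close> and \<open>q\<^sup>2\<close> are exactly what
  \<open>legendre_deriv_times_x\<close> and \<open>legendre_deriv_lower\<close> need, at \<open>u\<close> and at \<open>v\<close>, to turn the values at index
  \<open>l + 1\<close> into combinations of those at \<open>l\<close> and \<open>l + 2\<close>; in the sum of the products the mixed terms
  cancel.\<close>

lemma addition_coeff_rec_0:
  assumes q: "q\<^sup>2 = (1 - u\<^sup>2) * (1 - v\<^sup>2)"
  shows "(real l + 2) * addition_coeff u v q (Suc (Suc l)) 0 =
    (2 * real l + 3) * (u * v * addition_coeff u v q (Suc l) 0 + q * addition_coeff u v q (Suc l) 1)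
    - (real l + 1) * addition_coeff u v q l 0"
proof -
  define L a a' b b' d d' g g' where *:
    "L = real l" "a = poly (legendre_deriv 0 (Suc (Suc l))) u" "a' = poly (legendre_deriv 0 (Suc (Suc l))) v"
    "b = poly (legendre_deriv 0 l) u" "b' = poly (legendre_deriv 0 l) v"
    "d = poly (legendre_deriv 0 (Suc l)) u" "d' = poly (legendre_deriv 0 (Suc l)) v"
    "g = poly (legendre_deriv 1 (Suc l)) u" "g' = poly (legendre_deriv 1 (Suc l)) v"
  have L: "L + 1 > 0" "L + 2 > 0" "2 * L + 3 > 0" by (auto simp: *)
  have T: "(2 * L + 3) * (u * d) = (L + 2) * a + (L + 1) * b" 
    "(2 * L + 3) * (v * d') = (L + 2) * a' + (L + 1) * b'"
    using poly_legendre_deriv_times_x[of l _ 0] by (auto simp: *)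
  have W: "(2 * L + 3) * ((1 - u\<^sup>2) * g) = (L + 1) * (L + 2) * (b - a)"
    "(2 * L + 3) * ((1 - v\<^sup>2) * g') = (L + 1) * (L + 2) * (b' - a')"
    using poly_legendre_deriv_lower[of l _ 0] by (auto simp: * algebra_simps)
  have c1: "fact l / fact (l + 2) = 1 / ((L + 1) * (L + 2))"
    by (simp add: * divide_simps) (simp add: algebra_simps)
  have A: "addition_coeff u v q (Suc (Suc l)) 0 = a * a'" "addition_coeff u v q (Suc l) 0 = d * d'"
    "addition_coeff u v q l 0 = b * b'"
    by (simp_all add: addition_coeff_def *)
  have A1: "q * addition_coeff u v q (Suc l) 1 = (1 - u\<^sup>2) * (1 - v\<^sup>2) * g * g' / ((L + 1) * (L + 2))"
    using c1 by (simp add: addition_coeff_def * flip: q) (simp add: power2_eq_square)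
  have "(2 * L + 3) * ((L + 1) * (L + 2)) * ((L + 2) * (a * a')) =
    (2 * L + 3) * ((L + 1) * (L + 2)) * ((2 * L + 3) * (u * v * (d * d')) - (L + 1) * (b * b'))
     + (2 * L + 3) * (2 * L + 3) * ((1 - u\<^sup>2) * (1 - v\<^sup>2) * g * g')"
    using T W by algebra
  then have "(2 * L + 3) * ((L + 1) * (L + 2)) * ((L + 2) * (a * a')) = (2 * L + 3) * ((L + 1) * (L + 2)) *
      ((2 * L + 3) * (u * v * (d * d') + (1 - u\<^sup>2) * (1 - v\<^sup>2) * g * g' / ((L + 1) * (L + 2))) - (L + 1) * (b * b'))"
    using L by (simp add: divide_simps) (simp add: algebra_simps)
  then have "(L + 2) * (a * a') = 
      (2 * L + 3) * (u * v * (d * d') + (1 - u\<^sup>2) * (1 - v\<^sup>2) * g * g' / ((L + 1) * (L + 2))) - (L + 1) * (b * b')"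
    using L by (subst (asm) mult_cancel_left) auto
  then show ?thesis unfolding A A1 by (simp add: *)
qed

text \<open>The same for the harmonic \<open>M = m + 1\<close>, which receives contributions from its two neighbours:
  \<open>legendre_deriv_raise\<close> handles order \<open>m\<close>, \<open>legendre_deriv_lower\<close> order \<open>m + 2\<close>, and
  \<open>legendre_deriv_times_x\<close> order \<open>m + 1\<close>.\<close>

lemma addition_coeff_rec_Suc:
  assumes q: "q\<^sup>2 = (1 - u\<^sup>2) * (1 - v\<^sup>2)"
  shows "(real l + 2) * addition_coeff u v q (Suc (Suc l)) (Suc m) =
    (2 * real l + 3) * (u * v * addition_coeff u v q (Suc l) (Suc m)
       + q / 2 * (addition_coeff u v q (Suc l) m + addition_coeff u v q (Suc l) (Suc (Suc m))))
    - (real l + 1) * addition_coeff u v q l (Suc m)"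
proof -
  define L M a a' b b' d d' e e' g g' where *:
    "L = real l" "M = real (Suc m)" 
    "a = poly (legendre_deriv (Suc m) (Suc (Suc l))) u" "a' = poly (legendre_deriv (Suc m) (Suc (Suc l))) v"
    "b = poly (legendre_deriv (Suc m) l) u" "b' = poly (legendre_deriv (Suc m) l) v"
    "d = poly (legendre_deriv (Suc m) (Suc l)) u" "d' = poly (legendre_deriv (Suc m) (Suc l)) v"
    "e = poly (legendre_deriv m (Suc l)) u" "e' = poly (legendre_deriv m (Suc l)) v"
    "g = poly (legendre_deriv (Suc (Suc m)) (Suc l)) u" "g' = poly (legendre_deriv (Suc (Suc m)) (Suc l)) v"
  define C where "C = L + 1 + M"
  define N where "N = 2 * L + 3"
  have pos: "C > 0" "C + 1 > 0" "N > 0" by (auto simp: * C_def N_def)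
  have T: "N * (u * d) = (L + 2 - M) * a + C * b" 
    "N * (v * d') = (L + 2 - M) * a' + C * b'"
    using poly_legendre_deriv_times_x[of l _ "Suc m"] by (auto simp: * C_def N_def)
  have E: "N * e = a - b" "N * e' = a' - b'"
    using poly_legendre_deriv_raise[of l m] by (auto simp: * N_def)
  have W: "N * ((1 - u\<^sup>2) * g) = C * (C + 1) * b - (L + 1 - M) * (L + 2 - M) * a"
    "N * ((1 - v\<^sup>2) * g') = C * (C + 1) * b' - (L + 1 - M) * (L + 2 - M) * a'"
    using poly_legendre_deriv_lower[of l _ "Suc m"] by (auto simp: * C_def N_def algebra_simps)
  define F :: real where "F = fact (l + Suc m)"
  have F: "F > 0" by (simp add: F_def)
  have den: "fact (Suc (Suc l) + Suc m) = F * C * (C + 1)" "fact (Suc l + Suc m) = F * C"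
     "fact (Suc l + m) = F" "fact (Suc l + Suc (Suc m)) = F * C * (C + 1)" "fact (l + Suc m) = F"
    by (simp_all add: F_def C_def * algebra_simps)
  \<comment> \<open>\<open>R\<close> is the common factor of all coefficients, so that only the polynomial identity \<open>main\<close> remains.\<close>
  define R where "R = q ^ Suc m / (F * C * (C + 1) * N)"
  define f0 f1 f2 :: real where f: "f0 = fact (l - Suc m)" "f1 = fact (l - m)" "f2 = fact (Suc l - m)"
  have A: "addition_coeff u v q (Suc (Suc l)) (Suc m) = R * (N * f2 * (a * a'))"
    "addition_coeff u v q (Suc l) (Suc m) = R * (N * (C + 1) * f1 * (d * d'))"
    "q * addition_coeff u v q (Suc l) m = R * (N * C * (C + 1) * f2 * (e * e'))"
    "addition_coeff u v q l (Suc m) = R * (N * C * (C + 1) * f0 * (b * b'))"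
    using pos F unfolding addition_coeff_def den by (simp_all add: R_def * f mult_ac)
  have A2: "q * addition_coeff u v q (Suc l) (Suc (Suc m)) = R * (N * f0 * ((1 - u\<^sup>2) * (1 - v\<^sup>2) * (g * g')))"
  proof -
    have "q * q ^ Suc (Suc m) = q ^ Suc m * ((1 - u\<^sup>2) * (1 - v\<^sup>2))"
      unfolding q[symmetric] by (simp add: power2_eq_square)
    moreover have "q * addition_coeff u v q (Suc l) (Suc (Suc m)) =
        fact (l - Suc m) / (F * C * (C + 1)) * (q * q ^ Suc (Suc m)) * (g * g')"
      unfolding addition_coeff_def den by (simp add: * mult_ac)
    ultimately have "q * addition_coeff u v q (Suc l) (Suc (Suc m)) =
        fact (l - Suc m) / (F * C * (C + 1)) * (q ^ Suc m * ((1 - u\<^sup>2) * (1 - v\<^sup>2))) * (g * g')"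
      by (simp only:)
    then show ?thesis using pos F by (simp add: R_def f mult_ac)
  qed
  have main: "(L + 2) * (N * f2 * (a * a')) = N * (u * v * (N * (C + 1) * f1 * (d * d'))
      + (N * C * (C + 1) * f2 * (e * e') + N * f0 * ((1 - u\<^sup>2) * (1 - v\<^sup>2) * (g * g'))) / 2)
      - (L + 1) * (N * C * (C + 1) * f0 * (b * b'))"
  proof -
    have sq: "N * N * (u * v * (d * d')) = ((L + 2 - M) * a + C * b) * ((L + 2 - M) * a' + C * b')"
      "N * N * (e * e') = (a - b) * (a' - b')"
      "N * N * ((1 - u\<^sup>2) * (1 - v\<^sup>2) * (g * g')) =
        (C * (C + 1) * b - (L + 1 - M) * (L + 2 - M) * a) * (C * (C + 1) * b' - (L + 1 - M) * (L + 2 - M) * a')"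
      unfolding T[symmetric] E[symmetric] W[symmetric] by (simp_all add: mult_ac)
    have "N * (u * v * (N * (C + 1) * f1 * (d * d')) + (N * C * (C + 1) * f2 * Y + N * f0 * Z) / 2)
      = (C + 1) * f1 * (N * N * (u * v * (d * d'))) + C * (C + 1) * f2 / 2 * (N * N * Y)
        + f0 / 2 * (N * N * Z)" for Y Z
      by (simp add: field_simps)
    note rhs = this[of "e * e'" "(1 - u\<^sup>2) * (1 - v\<^sup>2) * (g * g')"]
    \<comment> \<open>Truncated subtraction makes the factorials irregular near the top order, where some derivatives vanish instead.\<close>
    consider "Suc m \<le> l" | "m = l" | "m = Suc l" | "m > Suc l" by linarith
    then show ?thesis
    proof cases
      case 1
      define k where "k = L + 1 - M"
      from 1 obtain j where j: "l = Suc (m + j)" by (metis le_Suc_ex add_Suc)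
      have f12: "f1 = k * f0" "f2 = (k + 1) * k * f0"
        by (simp_all add: f k_def * j algebra_simps Suc_diff_le)
      have LN: "L = (k + C) / 2 - 1" "N = k + C + 1" by (simp_all add: k_def C_def N_def field_simps)
      have LM: "L + 2 - M = k + 1" "L + 1 - M = k" by (simp_all add: k_def)
      show ?thesis unfolding rhs sq LM unfolding f12 LN by (simp add: field_simps)
    next
      case 2
      then have 0: "b = 0" "b' = 0" "g = 0" "g' = 0" by (auto simp: * legendre_deriv_eq_0)
      have 1: "f1 = 1" "f2 = 1" "L = M - 1" "C = 2 * M" "N = 2 * M + 1" using 2 by (simp_all add: f * C_def N_def)
      show ?thesis unfolding rhs sq unfolding 0 1 by (simp add: field_simps)
    next
      case 3
      then have 0: "b = 0" "b' = 0" "g = 0" "g' = 0" "d = 0" "d' = 0" by (auto simp: * legendre_deriv_eq_0)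
      have 1: "f1 = 1" "f2 = 1" "L = M - 2" "C = N" "N = 2 * M - 1" using 3 by (simp_all add: f * C_def N_def)
      show ?thesis unfolding rhs sq unfolding 0 1 by (simp add: field_simps)
    next
      case 4
      then have "a = 0" "b = 0" "b' = 0" "g = 0" "g' = 0" "d = 0" "d' = 0" "e = 0" by (auto simp: * legendre_deriv_eq_0)
      then show ?thesis by simp
    qed
  qed
  have "(L + 2) * addition_coeff u v q (Suc (Suc l)) (Suc m) = R * ((L + 2) * (N * f2 * (a * a')))"
    by (simp add: A)
  also have "\<dots> = N * (u * v * addition_coeff u v q (Suc l) (Suc m)
       + (q * addition_coeff u v q (Suc l) m + q * addition_coeff u v q (Suc l) (Suc (Suc m))) / 2)
    - (L + 1) * addition_coeff u v q l (Suc m)"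
    unfolding main A A2 by (simp add: algebra_simps add_divide_distrib)
  finally show ?thesis by (simp add: *(1) N_def algebra_simps add_divide_distrib)
qed

text \<open>Multiplication by \<open>cos t\<close> shifts a cosine sum by one index in both directions; the last two terms are the
  boundary effect of truncating at \<open>K\<close>.\<close>

lemma cos_times_cosine_sum:
  fixes a :: "nat \<Rightarrow> real"
  shows "cos t * (a 0 + 2 * (\<Sum>m<K. a (Suc m) * cos (real (Suc m) * t))) =
    a 1 + (\<Sum>m<K. (a m + a (Suc (Suc m))) * cos (real (Suc m) * t))
    + a K * cos (real (Suc K) * t) - a (Suc K) * cos (real K * t)"
proof (induction K)
  case 0
  show ?case by simp
next
  case (Suc K)
  have "2 * (cos t * cos (real (Suc K) * t)) = cos (real (Suc (Suc K)) * t) + cos (real K * t)"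
    using cos_add[of "real (Suc K) * t" t] cos_diff[of "real (Suc K) * t" t] by (simp add: algebra_simps)
  then have "cos t * (2 * (a (Suc K) * cos (real (Suc K) * t))) =
      a (Suc K) * (cos (real (Suc (Suc K)) * t) + cos (real K * t))"
    by (metis mult.left_commute)
  then show ?case using Suc.IH unfolding sum.lessThan_Suc by (simp add: algebra_simps)
qed

text \<open>The upper bound \<open>K\<close> is independent of \<open>l\<close> so that the sums for \<open>l\<close>, \<open>l + 1\<close> and \<open>l + 2\<close> have the same
  range in the induction; the additional coefficients are zero.\<close>

lemma legendre_addition_aux:
  assumes q: "q\<^sup>2 = (1 - u\<^sup>2) * (1 - v\<^sup>2)" and "l \<le> K"
  shows "poly (legendre_deriv 0 l) (u * v + q * cos t) =
    addition_coeff u v q l 0 + 2 * (\<Sum>m<K. addition_coeff u v q l (Suc m) * cos (real (Suc m) * t))"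
  using \<open>l \<le> K\<close>
proof (induction l rule: induct_nat_012)
  case 0
  then show ?case by (simp add: addition_coeff_eq_0 legendre_deriv_0_0 addition_coeff_def[of _ _ _ 0 0])
next
  case 1
  have x: "legendre_deriv 0 (Suc 0) = [:0, 1:]"
    by (simp add: legendre_deriv_def rodrigues_poly_def pderiv_pCons)
  have "legendre_deriv 1 (Suc 0) = 1"
    using pderiv_legendre_deriv[of 0 "Suc 0"] by (simp add: x pderiv_pCons one_pCons)
  then show ?case using 1
    by (cases K) (simp_all add: sum.lessThan_Suc_shift addition_coeff_eq_0 addition_coeff_def[of _ _ _ "Suc 0" 0]
      addition_coeff_def[of _ _ _ "Suc 0" "Suc 0"] x del: sum.lessThan_Suc)
next
  case (ge2 l)
  define A where "A = addition_coeff u v q"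
  define S where "S l = A l 0 + 2 * (\<Sum>m<K. A l (Suc m) * cos (real (Suc m) * t))" for l
  let ?w = "u * v + q * cos t"
  have IH: "poly (legendre_deriv 0 l) ?w = S l" "poly (legendre_deriv 0 (Suc l)) ?w = S (Suc l)"
    using ge2 by (simp_all add: S_def A_def)
  have "A (Suc l) K = 0" "A (Suc l) (Suc K) = 0" 
    using ge2.prems by (simp_all add: A_def addition_coeff_eq_0)
  then have cS: "cos t * S (Suc l) = A (Suc l) 1 + (\<Sum>m<K. (A (Suc l) m + A (Suc l) (Suc (Suc m))) * cos (real (Suc m) * t))"
    unfolding S_def cos_times_cosine_sum by simp
  have "(real l + 2) * poly (legendre_deriv 0 (Suc (Suc l))) ?w = (2 * real l + 3) * (?w * S (Suc l)) - (real l + 1) * S l"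
    using poly_legendre_deriv_times_x[of l ?w 0] by (simp add: IH)
  also have "?w * S (Suc l) = u * v * S (Suc l) + q * (cos t * S (Suc l))" by (simp add: algebra_simps)
  also have "(2 * real l + 3) * \<dots> - (real l + 1) * S l = 
     ((2 * real l + 3) * (u * v * A (Suc l) 0 + q * A (Suc l) 1) - (real l + 1) * A l 0)
     + 2 * (\<Sum>m<K. ((2 * real l + 3) * (u * v * A (Suc l) (Suc m)
       + q / 2 * (A (Suc l) m + A (Suc l) (Suc (Suc m)))) - (real l + 1) * A l (Suc m)) * cos (real (Suc m) * t))"
  proof -
    have "2 * (\<Sum>m<K. ((2 * real l + 3) * (u * v * A (Suc l) (Suc m)
       + q / 2 * (A (Suc l) m + A (Suc l) (Suc (Suc m)))) - (real l + 1) * A l (Suc m)) * cos (real (Suc m) * t)) =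
      (2 * real l + 3) * (u * v * (2 * (\<Sum>m<K. A (Suc l) (Suc m) * cos (real (Suc m) * t)))
        + q * (\<Sum>m<K. (A (Suc l) m + A (Suc l) (Suc (Suc m))) * cos (real (Suc m) * t)))
      - (real l + 1) * (2 * (\<Sum>m<K. A l (Suc m) * cos (real (Suc m) * t)))"
      unfolding sum_distrib_left sum.distrib[symmetric] sum_subtractf[symmetric]
      by (rule sum.cong) (simp_all add: field_simps)
    then show ?thesis unfolding cS unfolding S_def by (simp add: algebra_simps)
  qed
  also have "\<dots> = (real l + 2) * S (Suc (Suc l))"
    unfolding A_def S_def addition_coeff_rec_0[OF q, symmetric] addition_coeff_rec_Suc[OF q, symmetric]
    by (simp add: algebra_simps sum_distrib_left)
  finally show ?case by (simp add: S_def A_def)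
qed

lemma assoc_legendre_eq:
  "assoc_legendre l m u = (- 1) ^ m * sqrt (1 - u\<^sup>2) ^ m * poly (legendre_deriv m l) u"
  by (simp add: assoc_legendre_def higher_deriv_legendre_P)

text \<open>The case \<open>q = sin \<theta> sin \<theta>'\<close>: in the product of two associated functions the signs \<open>(-1)\<^sup>m\<close> cancel and the
  square roots combine to \<open>q\<^sup>m\<close>.\<close>

theorem legendre_addition:
  assumes "\<bar>u\<bar> \<le> 1" "\<bar>v\<bar> \<le> 1"
  shows "legendre_P l (u * v + sqrt (1 - u\<^sup>2) * sqrt (1 - v\<^sup>2) * cos t) =
    legendre_P l u * legendre_P l v +
    2 * (\<Sum>m=1..l. fact (l - m) / fact (l + m) * (assoc_legendre l m u * assoc_legendre l m v) * cos (real m * t))"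
proof -
  define q where "q = sqrt (1 - u\<^sup>2) * sqrt (1 - v\<^sup>2)"
  have "u\<^sup>2 \<le> 1" "v\<^sup>2 \<le> 1" using assms by (simp_all add: abs_square_le_1)
  then have q: "q\<^sup>2 = (1 - u\<^sup>2) * (1 - v\<^sup>2)"
    by (simp add: q_def power_mult_distrib)
  have c: "addition_coeff u v q l m = fact (l - m) / fact (l + m) * (assoc_legendre l m u * assoc_legendre l m v)" for m
  proof -
    have "(-1) ^ m * (-1) ^ m = (1::real)" by (simp flip: power_mult_distrib)
    then show ?thesis
      by (simp add: addition_coeff_def assoc_legendre_eq q_def power_mult_distrib)
  qed
  have "addition_coeff u v q l 0 = legendre_P l u * legendre_P l v"
    by (simp add: addition_coeff_def legendre_P_eq_poly)
  then show ?thesis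
    using legendre_addition_aux[OF q order.refl, of l t]
    unfolding One_nat_def sum.atLeast1_atMost_eq c[symmetric] q_def[symmetric] legendre_P_eq_poly by simp
qed

section \<open>Integration over the polar angle\<close>

lemma higher_pderiv_linear_power:
  "(pderiv ^^ n) ([:c, 1:] ^ (N + n)) = smult (fact (N + n) / fact N) ([:c, 1 :: real:] ^ N)"
proof (induction n arbitrary: N)
  case (Suc n)
  have "(pderiv ^^ Suc n) ([:c, 1:] ^ (N + Suc n)) = pderiv ((pderiv ^^ n) ([:c, 1:] ^ (Suc N + n)))"
    by simp
  also have "\<dots> = smult (fact (Suc N + n) / fact (Suc N)) (smult (real (Suc N)) ([:c, 1:] ^ N))"
    unfolding Suc.IH pderiv_smult pderiv_power_Suc by (simp add: pderiv_pCons flip: one_pCons)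
  also have "\<dots> = smult (fact (N + Suc n) / fact N) ([:c, 1:] ^ N)"
    by (simp add: divide_simps del: of_nat_Suc)
  finally show ?case .
qed simp

lemma smult_sum_right: "smult c (\<Sum>i\<in>A. p i) = (\<Sum>i\<in>A. smult c (p i))"
  by (induction A rule: infinite_finite_induct) (simp_all add: smult_add_right)

text \<open>Binomial expansion of \<open>(x\<^sup>2 - 1)\<^sup>l = (x - 1)\<^sup>l ((x - 1) + 2)\<^sup>l\<close>.\<close>

lemma rodrigues_poly_shifted:
  "rodrigues_poly l = (\<Sum>k\<le>l. smult (real (l choose k) / (2 ^ k * fact l)) ([:- 1, 1:] ^ (l + k)))"
proof -
  have "[:- 1, 0, 1:] = [:- 1, 1:] * ([:- 1, 1:] + [:2 :: real:])" by simp
  then have "[:- 1, 0, 1:] ^ l = [:- 1, 1:] ^ l * ([:- 1, 1:] + [:2 :: real:]) ^ l"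
    by (simp only: power_mult_distrib)
  also have "([:- 1, 1:] + [:2 :: real:]) ^ l = (\<Sum>k\<le>l. of_nat (l choose k) * [:- 1, 1:] ^ k * [:2:] ^ (l - k))"
    by (rule binomial_ring)
  also have "[:- 1, 1:] ^ l * \<dots> = (\<Sum>k\<le>l. smult (real (l choose k) * 2 ^ (l - k)) ([:- 1, 1:] ^ (l + k)))"
    unfolding sum_distrib_left
    by (intro sum.cong refl) (simp add: power_add of_nat_poly poly_const_pow mult_ac)
  finally have "rodrigues_poly l = (\<Sum>k\<le>l. smult (1 / (2 ^ l * fact l) * (real (l choose k) * 2 ^ (l - k))) ([:- 1, 1:] ^ (l + k)))"
    by (simp only: rodrigues_poly_def smult_sum_right smult_smult)
  also have "\<dots> = (\<Sum>k\<le>l. smult (real (l choose k) / (2 ^ k * fact l)) ([:- 1, 1:] ^ (l + k)))"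
    by (intro sum.cong refl arg_cong2[where f = smult]) (auto simp: divide_simps simp flip: power_add)
  finally show ?thesis .
qed

text \<open>The expansion of \<open>P\<^sub>l\<close> about \<open>1\<close>, differentiated \<open>m\<close> times: of the powers \<open>(x - 1)\<^sup>l\<^sup>+\<^sup>k\<close> in the shifted
  Rodrigues polynomial, \<open>l + m\<close> derivatives annihilate those with \<open>k < m\<close>.\<close>

lemma poly_legendre_deriv_shifted:
  "poly (legendre_deriv m l) u =
     (\<Sum>k=m..l. real (l choose k) * real ((l + k) choose k) * (fact k / fact (k - m)) * ((u - 1) ^ (k - m) / 2 ^ k))"
proof -
  have z: "(pderiv ^^ (l + m)) ([:- 1, 1 :: real:] ^ (l + k)) = 0" if "k < m" for k
  proof (rule higher_pderiv_eq_0)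
    show "degree ([:- 1, 1 :: real:] ^ (l + k)) < l + m"
      using that by (simp add: degree_power_eq)
  qed
  have nz: "(pderiv ^^ (l + m)) ([:- 1, 1 :: real:] ^ (l + k)) =
      smult (fact (l + k) / fact (k - m)) ([:- 1, 1:] ^ (k - m))" if "m \<le> k" for k
    using higher_pderiv_linear_power[of "l + m" "- 1" "k - m"] that by (simp add: add.commute)
  have "poly (legendre_deriv m l) u =
     (\<Sum>k\<le>l. real (l choose k) / (2 ^ k * fact l) * poly ((pderiv ^^ (l + m)) ([:- 1, 1:] ^ (l + k))) u)"
    by (simp add: legendre_deriv_def rodrigues_poly_shifted higher_pderiv_sum higher_pderiv_smult poly_sum)
  also have "\<dots> = (\<Sum>k=m..l. real (l choose k) / (2 ^ k * fact l) * poly ((pderiv ^^ (l + m)) ([:- 1, 1:] ^ (l + k))) u)"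
    by (rule sum.mono_neutral_right) (auto simp: z)
  also have "\<dots> = (\<Sum>k=m..l. real (l choose k) * real ((l + k) choose k) * (fact k / fact (k - m)) * ((u - 1) ^ (k - m) / 2 ^ k))"
  proof (rule sum.cong[OF refl])
    fix k assume "k \<in> {m..l}"
    then have "m \<le> k" by simp
    have "real ((l + k) choose k) = fact (l + k) / (fact k * fact l)" by (simp add: binomial_fact)
    then show "real (l choose k) / (2 ^ k * fact l) * poly ((pderiv ^^ (l + m)) ([:- 1, 1:] ^ (l + k))) u =
      real (l choose k) * real ((l + k) choose k) * (fact k / fact (k - m)) * ((u - 1) ^ (k - m) / 2 ^ k)"
      unfolding nz[OF \<open>m \<le> k\<close>] by (simp add: mult_ac)
  qed
  finally show ?thesis .
qed

text \<open>In the variable \<open>t = (1 + u) / 2\<close> one has \<open>1 - u\<^sup>2 = 4 t (1 - t)\<close> and \<open>u - 1 = -2 (1 - t)\<close>; all powers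
  of 2 cancel and the sign that remains is \<open>(-1)\<^sup>k\<close>. At \<open>t = 1\<close> the splitting of the exponent \<open>k - m/2\<close>
  relies on both sides being zero, which uses \<open>m > 0\<close>.\<close>

lemma sin_power_times_half_angle:
  assumes "\<bar>u\<bar> \<le> 1" "1 \<le> m" "m \<le> k"
  shows "(- 1) ^ m * sqrt (1 - u\<^sup>2) ^ m * ((u - 1) ^ (k - m) / 2 ^ k) =
    (- 1) ^ k * (((1 + u) / 2) powr (real m / 2) * (1 - (1 + u) / 2) powr (real k - real m / 2))"
proof -
  obtain j where k: "k = m + j" using assms(3) le_Suc_ex by blast
  define t w where tw: "t = (1 + u) / 2" "w = (1 - u) / 2"
  have nonneg: "t \<ge> 0" "w \<ge> 0" using assms(1) by (auto simp: tw)
  have half: "sqrt x ^ m = x powr (real m / 2)" if "x \<ge> 0" for x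
  proof (cases "x = 0")
    case False
    then show ?thesis using that by (simp add: powr_half_sqrt[symmetric] powr_powr flip: powr_realpow)
  qed (use assms(2) in simp)
  have "1 - u\<^sup>2 = 2\<^sup>2 * (t * w)" by (simp add: tw power2_eq_square field_simps)
  then have sq: "sqrt (1 - u\<^sup>2) = 2 * (sqrt t * sqrt w)" by (simp add: real_sqrt_mult)
  have w: "w powr (real k - real m / 2) = w powr (real m / 2) * w ^ j"
  proof (cases "w = 0")
    case True
    then show ?thesis using assms(2) by simp
  next
    case False
    then have "w powr (real k - real m / 2) = w powr (real m / 2 + real j)" by (simp add: k)
    then show ?thesis using False nonneg by (simp add: powr_add powr_realpow)
  qed
  have u1: "u - 1 = (- 1) * (2 * w)" by (simp add: tw)
  then have u: "(u - 1) ^ (k - m) = (- 1) ^ j * (2 ^ j * w ^ j)"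
    by (simp only: u1 k diff_add_inverse power_mult_distrib)
  have "1 - (1 + u) / 2 = w" by (simp add: tw field_simps)
  then show ?thesis
    unfolding sq u tw(1)[symmetric]
    by (simp add: power_mult_distrib half nonneg w) (simp add: k power_add)
qed

text \<open>The substitution \<open>t = (1 + cos \<theta>) / 2\<close>, with \<open>dt = - sin \<theta> d\<theta> / 2\<close>, carried out on the primitive: \<open>-2\<close>
  times the incomplete Beta function of \<open>t\<close> is differentiable on the closed interval, since the Beta integrand is
  continuous up to the endpoints for \<open>a, b > 1\<close>.\<close>

lemma has_integral_beta_cos:
  assumes "0 \<le> \<theta>1" "\<theta>1 \<le> \<theta>2" "\<theta>2 \<le> pi" "1 < a" "1 < b"
  shows "((\<lambda>\<theta>. ((1 + cos \<theta>) / 2) powr (a - 1) * (1 - (1 + cos \<theta>) / 2) powr (b - 1) * sin \<theta>) has_integral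
    2 * (inc_beta ((1 + cos \<theta>1) / 2) a b - inc_beta ((1 + cos \<theta>2) / 2) a b)) {\<theta>1..\<theta>2}"
proof -
  define \<beta> where "\<beta> t = t powr (a - 1) * (1 - t) powr (b - 1)" for t :: real
  have cont: "continuous_on {0..1} \<beta>"
    unfolding \<beta>_def using assms by (intro continuous_intros continuous_on_powr') auto
  define t where "t \<theta> = (1 + cos \<theta>) / 2" for \<theta> :: real
  have t01: "t x \<in> {0..1}" for x
  proof -
    have "0 \<le> 1 + cos x" using cos_ge_minus_one[of x] by linarith
    then show ?thesis using cos_le_one[of x] by (simp add: t_def)
  qed
  have "((\<lambda>x. - 2 * inc_beta (t x) a b) has_real_derivative \<beta> (t x) * sin x) (at x within {\<theta>1..\<theta>2})" for x
  proof -
    have "(t has_real_derivative - sin x / 2) (at x within {\<theta>1..\<theta>2})"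
      unfolding t_def by (auto intro!: derivative_eq_intros)
    moreover have "((\<lambda>u. inc_beta u a b) has_real_derivative \<beta> (t x)) (at (t x) within {0..1})"
      unfolding inc_beta_def \<beta>_def[symmetric] using cont t01 by (rule integral_has_real_derivative)
    then have "((\<lambda>u. inc_beta u a b) has_real_derivative \<beta> (t x)) (at (t x) within t ` {\<theta>1..\<theta>2})"
      by (rule DERIV_subset) (use t01 in auto)
    ultimately have "((\<lambda>u. inc_beta u a b) \<circ> t has_real_derivative \<beta> (t x) * (- sin x / 2)) (at x within {\<theta>1..\<theta>2})"
      by (intro DERIV_image_chain)
    from DERIV_cmult[OF this, of "- 2"] show ?thesis by (simp add: o_def)
  qed
  then have "((\<lambda>x. \<beta> (t x) * sin x) has_integral (- 2 * inc_beta (t \<theta>2) a b - - 2 * inc_beta (t \<theta>1) a b)) {\<theta>1..\<theta>2}"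
    using assms by (intro fundamental_theorem_of_calculus) (auto simp flip: has_real_derivative_iff_has_vector_derivative)
  then show ?thesis by (simp add: \<beta>_def t_def algebra_simps)
qed

lemma has_integral_assoc_legendre_cos:
  assumes "0 \<le> \<theta>1" "\<theta>1 \<le> \<theta>2" "\<theta>2 \<le> pi" "1 \<le> m"
  shows "((\<lambda>\<theta>. assoc_legendre l m (cos \<theta>) * sin \<theta>) has_integral
    (\<Sum>k=m..l. real (l choose k) * real ((l + k) choose k) * (2 * (- 1) ^ k * fact k / fact (k - m)) *
        B_diff m k (cos \<theta>2) (cos \<theta>1))) {\<theta>1..\<theta>2}"
proof -
  define c where "c k = real (l choose k) * real ((l + k) choose k) * (fact k / fact (k - m))" for k
  have "((\<lambda>\<theta>. \<Sum>k=m..l. (c k * (- 1) ^ k) *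
      (((1 + cos \<theta>) / 2) powr ((real m / 2 + 1) - 1) * (1 - (1 + cos \<theta>) / 2) powr ((real k - real m / 2 + 1) - 1) * sin \<theta>))
    has_integral (\<Sum>k=m..l. (c k * (- 1) ^ k) * (2 * B_diff m k (cos \<theta>2) (cos \<theta>1)))) {\<theta>1..\<theta>2}"
    unfolding B_diff_def using assms
    by (intro has_integral_sum has_integral_mult_right has_integral_beta_cos) auto
  also have "(\<lambda>\<theta>. \<Sum>k=m..l. (c k * (- 1) ^ k) *
      (((1 + cos \<theta>) / 2) powr ((real m / 2 + 1) - 1) * (1 - (1 + cos \<theta>) / 2) powr ((real k - real m / 2 + 1) - 1) * sin \<theta>))
    = (\<lambda>\<theta>. assoc_legendre l m (cos \<theta>) * sin \<theta>)"
  proof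
    fix \<theta> :: real
    have "assoc_legendre l m (cos \<theta>) =
        (\<Sum>k=m..l. c k * ((- 1) ^ m * sqrt (1 - (cos \<theta>)\<^sup>2) ^ m * ((cos \<theta> - 1) ^ (k - m) / 2 ^ k)))"
      unfolding assoc_legendre_eq poly_legendre_deriv_shifted sum_distrib_left
      by (intro sum.cong refl) (simp add: c_def mult_ac)
    also have "\<dots> = (\<Sum>k=m..l. c k * ((- 1) ^ k * (((1 + cos \<theta>) / 2) powr (real m / 2) *
        (1 - (1 + cos \<theta>) / 2) powr (real k - real m / 2))))"
      using assms by (intro sum.cong refl arg_cong2[where f = times] sin_power_times_half_angle) auto
    finally have eq: "assoc_legendre l m (cos \<theta>) = \<dots>" .
    show "(\<Sum>k=m..l. (c k * (- 1) ^ k) * (((1 + cos \<theta>) / 2) powr ((real m / 2 + 1) - 1) *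
      (1 - (1 + cos \<theta>) / 2) powr ((real k - real m / 2 + 1) - 1) * sin \<theta>)) = assoc_legendre l m (cos \<theta>) * sin \<theta>"
      unfolding eq sum_distrib_right by (intro sum.cong refl) (simp add: mult_ac)
  qed
  finally show ?thesis by (simp add: c_def mult_ac)
qed

lemma has_integral_legendre_cos:
  assumes "\<theta>1 \<le> \<theta>2"
  shows "((\<lambda>\<theta>. legendre_P l (cos \<theta>) * sin \<theta>) has_integral
    (\<Sum>k=0..l. real (l choose k) * real ((l + k) choose k) * (- 1 / 2) ^ k * (1 / (real k + 1)) *
        ((1 - cos \<theta>2) ^ (k + 1) - (1 - cos \<theta>1) ^ (k + 1)))) {\<theta>1..\<theta>2}"
proof -
  define c where "c k = real (l choose k) * real ((l + k) choose k) * (- 1 / 2) ^ k" for k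
  have "((\<lambda>\<theta>. (1 - cos \<theta>) ^ k * sin \<theta>) has_integral
      1 / (real k + 1) * (1 - cos \<theta>2) ^ (k + 1) - 1 / (real k + 1) * (1 - cos \<theta>1) ^ (k + 1)) {\<theta>1..\<theta>2}" for k
  proof (rule fundamental_theorem_of_calculus[OF assms])
    fix x
    have "((\<lambda>x. 1 - cos x) has_real_derivative sin x) (at x within {\<theta>1..\<theta>2})"
      by (auto intro!: derivative_eq_intros)
    from DERIV_cmult[OF DERIV_power[OF this, of "k + 1"], of "1 / (real k + 1)"]
    have "((\<lambda>x. 1 / (real k + 1) * (1 - cos x) ^ (k + 1)) has_real_derivative
      1 / (real k + 1) * ((real k + 1) * (1 - cos x) ^ k * sin x)) (at x within {\<theta>1..\<theta>2})"
      by (simp add: mult_ac add.commute)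
    then show "((\<lambda>x. 1 / (real k + 1) * (1 - cos x) ^ (k + 1)) has_vector_derivative (1 - cos x) ^ k * sin x) (at x within {\<theta>1..\<theta>2})"
      by (simp add: has_real_derivative_iff_has_vector_derivative add_eq_0_iff)
  qed
  then have "((\<lambda>\<theta>. \<Sum>k=0..l. c k * ((1 - cos \<theta>) ^ k * sin \<theta>)) has_integral
      (\<Sum>k=0..l. c k * (1 / (real k + 1) * (1 - cos \<theta>2) ^ (k + 1) - 1 / (real k + 1) * (1 - cos \<theta>1) ^ (k + 1)))) {\<theta>1..\<theta>2}"
    by (intro has_integral_sum has_integral_mult_right) auto
  also have "(\<lambda>\<theta>. \<Sum>k=0..l. c k * ((1 - cos \<theta>) ^ k * sin \<theta>)) = (\<lambda>\<theta>. legendre_P l (cos \<theta>) * sin \<theta>)"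
  proof
    fix \<theta> :: real
    have "(cos \<theta> - 1) ^ k / 2 ^ k = (- 1 / 2) ^ k * (1 - cos \<theta>) ^ k" for k
      by (simp add: power_divide[symmetric] power_mult_distrib[symmetric] diff_divide_distrib)
    then show "(\<Sum>k=0..l. c k * ((1 - cos \<theta>) ^ k * sin \<theta>)) = legendre_P l (cos \<theta>) * sin \<theta>"
      unfolding legendre_P_eq_poly poly_legendre_deriv_shifted sum_distrib_right
      by (intro sum.cong refl) (simp add: c_def)
  qed
  finally show ?thesis by (simp add: c_def right_diff_distrib diff_divide_distrib mult_ac)
qed

section \<open>Surface integrals over coordinate rectangles\<close>

lemma continuous_on_sph: "continuous_on A (\<lambda>p. sph (fst p) (snd p))"
proof -
  have "continuous_on A (\<lambda>p :: real \<times> real. sph (fst p) (snd p) $ i)" for i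
  proof -
    consider "i = 1" | "i = 2" | "i = 3" using exhaust_3[of i] by blast
    then show ?thesis
      by cases (simp_all only: sph_def vector_3, (intro continuous_intros)+)
  qed
  then show ?thesis
    by (subst continuous_on_componentwise) (auto simp: Basis_vec_def inner_axis)
qed

lemma sph_inner_sph:
  "sph \<theta> \<phi> \<bullet> sph \<theta>' \<phi>' = cos \<theta> * cos \<theta>' + sin \<theta> * sin \<theta>' * cos (\<phi> - \<phi>')"
  unfolding inner_vec_def sph_def sum_3 vector_3 inner_real_def cos_diff by algebra

text \<open>Away from the poles spherical coordinates are unique, except that the meridians \<open>\<phi> = \<plusminus>\<pi>\<close> coincide; the strict
  bounds on \<open>\<phi>\<close> alone rule this out.\<close>

lemma sph_inj:
  assumes eq: "sph \<theta> \<phi> = sph \<theta>' \<phi>'" and "\<theta> \<in> {0..pi}" "\<theta>' \<in> {0..pi}" "sin \<theta> \<noteq> 0"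
    and \<phi>: "\<phi> \<in> {-pi<..<pi}" "\<phi>' \<in> {-pi..pi}"
  shows "\<theta> = \<theta>' \<and> \<phi> = \<phi>'"
proof -
  have c: "sph \<theta> \<phi> $ i = sph \<theta>' \<phi>' $ i" for i by (simp add: eq)
  have "cos \<theta> = cos \<theta>'" using c[of 3] by (simp add: sph_def)
  then have \<theta>: "\<theta> = \<theta>'" using assms by (auto intro: cos_inj_pi)
  then have "cos \<phi> = cos \<phi>'" "sin \<phi> = sin \<phi>'"
    using c[of 1] c[of 2] assms(4) by (simp_all add: sph_def)
  then have "cos (\<phi> - \<phi>') = 1" by (simp add: cos_diff flip: power2_eq_square)
  then obtain n :: int where n: "\<phi> - \<phi>' = real_of_int n * 2 * pi" using cos_one_2pi_int by auto
  have "\<bar>\<phi> - \<phi>'\<bar> < 2 * pi" using \<phi> by auto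
  then have "\<bar>real_of_int n\<bar> * (2 * pi) < 1 * (2 * pi)" unfolding n by (simp add: abs_mult)
  then have "\<bar>real_of_int n\<bar> < 1" by (simp add: mult_less_cancel_right)
  then have "n = 0" by linarith
  then show ?thesis using \<theta> n by simp
qed

lemma AE_snd_neq: "AE p in lborel. snd (p :: real \<times> real) \<noteq> c"
  unfolding lborel_prod[symmetric]
proof (rule lborel_pair.AE_pair_measure)
  show "{p \<in> space (lborel \<Otimes>\<^sub>M lborel). snd p \<noteq> c} \<in> sets (lborel \<Otimes>\<^sub>M lborel)"
    by measurable
qed (simp add: AE_lborel_singleton)

text \<open>The region is an image of the rectangle, whereas the surface measure counts its preimage in
  \<open>[0, \<pi>] \<times> (-\<pi>, \<pi>]\<close>. The two sets of parameters differ at most at the poles, where the density \<open>sin \<theta>\<close>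
  vanishes, and on the lines \<open>\<phi> = \<plusminus>\<pi>\<close>, which are null.\<close>

lemma set_integral_sphere_region:
  fixes F :: "real ^ 3 \<Rightarrow> real"
  assumes F: "continuous_on UNIV F"
    and \<theta>: "0 \<le> \<theta>1" "\<theta>2 \<le> pi" and \<phi>: "- pi \<le> \<phi>1" "\<phi>2 \<le> pi"
  shows "(LINT x:region \<theta>1 \<theta>2 \<phi>1 \<phi>2|sphere_measure. F x) =
    integral {\<theta>1..\<theta>2} (\<lambda>\<theta>. integral {\<phi>1..\<phi>2} (\<lambda>\<phi>. F (sph \<theta> \<phi>)) * sin \<theta>)"
proof -
  define R where "R = cbox (\<theta>1, \<phi>1) (\<theta>2, \<phi>2)"
  have R: "R = {\<theta>1..\<theta>2} \<times> {\<phi>1..\<phi>2}" by (simp add: R_def cbox_Pair_eq)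
  define S where "S p = sph (fst p) (snd p)" for p
  let ?A = "region \<theta>1 \<theta>2 \<phi>1 \<phi>2"
  have A: "?A = S ` R" by (simp add: region_def R S_def case_prod_beta')
  have "compact ?A"
    unfolding A R_def S_def by (intro compact_continuous_image continuous_on_sph compact_cbox)
  then have Am: "?A \<in> sets borel" by (simp add: borel_compact)
  define D where "D p = indicator ({0..pi} \<times> {-pi<..pi}) p * sin (fst p)" for p :: "real \<times> real"
  have sm: "sphere_measure = distr (density lborel (\<lambda>p. ennreal (D p))) (restrict_space borel S2) S"
    by (simp add: sphere_measure_def D_def S_def[abs_def] case_prod_beta')
  have S: "S \<in> borel \<rightarrow>\<^sub>M restrict_space borel S2"
    using measurable_sph by (simp add: S_def[abs_def] case_prod_beta')
  have Fm: "F \<in> borel_measurable borel" using F by (rule borel_measurable_continuous_onI)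
  have G: "(\<lambda>x. indicator ?A x *\<^sub>R F x) \<in> borel_measurable borel"
    using Am Fm by simp
  then have Gr: "(\<lambda>x. indicator ?A x *\<^sub>R F x) \<in> borel_measurable (restrict_space borel S2)"
    by (rule measurable_restrict_space1)
  have "(\<lambda>p :: real \<times> real. sin (fst p)) \<in> borel_measurable borel"
    by (intro borel_measurable_continuous_onI continuous_intros)
  moreover have "{0..pi} \<times> {-pi<..pi} \<in> sets (borel :: (real \<times> real) measure)"
    unfolding borel_prod[symmetric] by (intro pair_measureI) auto
  ultimately have Dm: "D \<in> borel_measurable borel"
    unfolding D_def by (intro borel_measurable_times) auto
  have GS: "(\<lambda>p. indicator ?A (S p) *\<^sub>R F (S p)) \<in> borel_measurable borel"
    using measurable_compose[OF S Gr] .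
  have cont: "continuous_on R (\<lambda>p. F (S p) * sin (fst p))"
    unfolding S_def by (intro continuous_intros continuous_on_compose2[OF F] continuous_on_sph) auto
  have int: "set_integrable lborel R (\<lambda>p. F (S p) * sin (fst p))"
    unfolding set_integrable_def R_def
    by (rule borel_integrable_compact) (use cont in \<open>auto simp: R_def\<close>)
  have "(LINT x:?A|sphere_measure. F x) = (LINT p|density lborel (\<lambda>p. ennreal (D p)). indicator ?A (S p) *\<^sub>R F (S p))"
    unfolding set_lebesgue_integral_def sm using S Gr by (subst integral_distr) simp_all
  also have "\<dots> = (LINT p|lborel. D p *\<^sub>R (indicator ?A (S p) *\<^sub>R F (S p)))"
  proof (rule integral_density)
    show "AE p in lborel. 0 \<le> D p"
      by (rule AE_I2) (auto simp: D_def indicator_def sin_ge_zero)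
  qed (use GS Dm in simp_all)
  also have "\<dots> = (LINT p|lborel. indicator R p *\<^sub>R (F (S p) * sin (fst p)))"
  proof (rule integral_cong_AE)
    show "(\<lambda>p. D p *\<^sub>R (indicator ?A (S p) *\<^sub>R F (S p))) \<in> borel_measurable lborel"
      using GS Dm by simp
    show "(\<lambda>p. indicator R p *\<^sub>R (F (S p) * sin (fst p))) \<in> borel_measurable lborel"
      using int by (auto simp: set_integrable_def)
    have eq: "D p *\<^sub>R (indicator ?A (S p) *\<^sub>R F (S p)) = indicator R p *\<^sub>R (F (S p) * sin (fst p))"
      if p: "snd p \<noteq> - pi" "snd p \<noteq> pi" for p
    proof -
      have "p \<in> R" if "S p \<in> ?A" "sin (fst p) \<noteq> 0" "p \<in> {0..pi} \<times> {-pi<..pi}"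
      proof -
        from \<open>S p \<in> ?A\<close> obtain p' where p': "p' \<in> R" "S p = S p'" by (auto simp: A)
        then have "fst p = fst p' \<and> snd p = snd p'"
          using that p \<theta> \<phi> unfolding S_def
          by (intro sph_inj) (auto simp: R)
        then have "p = p'" by (simp add: prod_eq_iff)
        then show ?thesis using p' by simp
      qed
      moreover have "S p \<in> ?A \<and> p \<in> {0..pi} \<times> {-pi<..pi}" if "p \<in> R"
        using that p \<theta> \<phi> by (auto simp: A R)
      ultimately show ?thesis by (auto simp: D_def indicator_def)
    qed
    show "AE p in lborel. D p *\<^sub>R (indicator ?A (S p) *\<^sub>R F (S p)) = indicator R p *\<^sub>R (F (S p) * sin (fst p))"
      using AE_snd_neq[of "- pi"] AE_snd_neq[of pi] by eventually_elim (rule eq)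
  qed
  also have "\<dots> = integral R (\<lambda>p. F (S p) * sin (fst p))"
    using set_borel_integral_eq_integral(2)[OF int] by (simp add: set_lebesgue_integral_def)
  also have "\<dots> = integral {\<theta>1..\<theta>2} (\<lambda>\<theta>. integral {\<phi>1..\<phi>2} (\<lambda>\<phi>. F (sph \<theta> \<phi>)) * sin \<theta>)"
    using integral_prod_continuous[OF cont[unfolded R_def]] by (simp add: R_def S_def)
  finally show ?thesis .
qed

section \<open>The probability of a coordinate rectangle\<close>

lemma has_integral_legendre_azimuth:
  assumes "\<phi>1 \<le> \<phi>2" "\<theta> \<in> {0..pi}" "\<theta>' \<in> {0..pi}"
  shows "((\<lambda>\<phi>. legendre_P l (sph \<theta> \<phi> \<bullet> sph \<theta>' \<phi>')) has_integral
    (\<phi>2 - \<phi>1) * (legendre_P l (cos \<theta>) * legendre_P l (cos \<theta>')) +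
    2 * (\<Sum>m=1..l. fact (l - m) / fact (l + m) * (assoc_legendre l m (cos \<theta>) * assoc_legendre l m (cos \<theta>')) *
      (1 / real m * (sin (real m * (\<phi>2 - \<phi>')) - sin (real m * (\<phi>1 - \<phi>')))))) {\<phi>1..\<phi>2}"
proof -
  have "sqrt (1 - (cos \<theta>)\<^sup>2) = sin \<theta>" "sqrt (1 - (cos \<theta>')\<^sup>2) = sin \<theta>'"
    using assms sin_cos_sqrt[of \<theta>] sin_cos_sqrt[of \<theta>'] by (simp_all add: sin_ge_zero)
  then have eq: "legendre_P l (sph \<theta> \<phi> \<bullet> sph \<theta>' \<phi>') = legendre_P l (cos \<theta>) * legendre_P l (cos \<theta>') +
    2 * (\<Sum>m=1..l. fact (l - m) / fact (l + m) * (assoc_legendre l m (cos \<theta>) * assoc_legendre l m (cos \<theta>')) *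
      cos (real m * (\<phi> - \<phi>')))" for \<phi>
    using legendre_addition[of "cos \<theta>" "cos \<theta>'" l "\<phi> - \<phi>'"] by (simp add: sph_inner_sph)
  have cos: "((\<lambda>\<phi>. cos (real m * (\<phi> - \<phi>'))) has_integral
      1 / real m * (sin (real m * (\<phi>2 - \<phi>')) - sin (real m * (\<phi>1 - \<phi>')))) {\<phi>1..\<phi>2}" if "m \<in> {1..l}" for m
  proof -
    have "((\<lambda>\<phi>. cos (real m * (\<phi> - \<phi>'))) has_integral
      1 / real m * sin (real m * (\<phi>2 - \<phi>')) - 1 / real m * sin (real m * (\<phi>1 - \<phi>'))) {\<phi>1..\<phi>2}"
    proof (rule fundamental_theorem_of_calculus[OF assms(1)])
      fix x
      have "((\<lambda>x. 1 / real m * sin (real m * (x - \<phi>'))) has_real_derivative cos (real m * (x - \<phi>'))) (at x within {\<phi>1..\<phi>2})"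
        using that by (auto intro!: derivative_eq_intros)
      then show "((\<lambda>x. 1 / real m * sin (real m * (x - \<phi>'))) has_vector_derivative cos (real m * (x - \<phi>'))) (at x within {\<phi>1..\<phi>2})"
        by (simp add: has_real_derivative_iff_has_vector_derivative)
    qed
    then show ?thesis by (simp add: right_diff_distrib)
  qed
  have const: "((\<lambda>\<phi>. c) has_integral (\<phi>2 - \<phi>1) * c) {\<phi>1..\<phi>2}" for c :: real
    using has_integral_const_real[of c \<phi>1 \<phi>2] assms(1) by simp
  show ?thesis unfolding eq
    by (intro has_integral_add const has_integral_mult_right has_integral_sum cos) auto
qed

lemma N_norm_sq: "(N_norm l m)\<^sup>2 = (2 * real l + 1) / (4 * pi) * (fact (l - m) / fact (l + m))"
  by (simp add: N_norm_def power_mult_distrib)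

theorem theorem4p1:
  fixes M :: "'a measure" and X :: "'a \<Rightarrow> real ^ 3" and Xs :: "nat \<Rightarrow> 'a \<Rightarrow> real ^ 3"
    and f :: "real ^ 3 \<Rightarrow> real" and s r h :: real and n :: nat and g :: "real \<Rightarrow> real"
    and \<theta> \<phi> :: "nat \<Rightarrow> 'a \<Rightarrow> real" and \<theta>1 \<theta>2 \<phi>1 \<phi>2 :: real and \<omega> :: 'a
  assumes "prob_space M"
    and "s > 0"
    and "f \<in> Linf_sphere \<inter> holder_sphere s"
    and "AE x in sphere_measure. 0 \<le> f x"
    and "distributed M sphere_measure X (\<lambda>x. ennreal (f x))"
    and "n \<ge> 1"
    and "prob_space.indep_vars M (\<lambda>_. sphere_measure) Xs {1..n}"
    and "\<And>j. j \<in> {1..n} \<Longrightarrow> distr M sphere_measure (Xs j) = distr M sphere_measure X"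
    and "h = real n powr (- 1 / (2 * s + 2))"
    and "admissible s r g"
    and "0 \<le> \<theta>1" "\<theta>1 < \<theta>2" "\<theta>2 \<le> pi"
    and "- pi \<le> \<phi>1" "\<phi>1 < \<phi>2" "\<phi>2 \<le> pi"
    and "\<omega> \<in> space M"
    and "\<And>j. j \<in> {1..n} \<Longrightarrow> is_sph_coords (Xs j \<omega>) (\<theta> j \<omega>) (\<phi> j \<omega>)"
  shows "P_hat s r g h n (\<lambda>j. Xs j \<omega>) (region \<theta>1 \<theta>2 \<phi>1 \<phi>2) =
    1 / real n * (\<Sum>j=1..n. \<Sum>l=0..N_trunc s r n.
      g (h * sqrt (real l * (real l + 1))) *
      (I_zero \<theta>1 \<theta>2 \<phi>1 \<phi>2 l (\<theta> j \<omega>) +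
       2 * (\<Sum>m=1..l. I_pos \<theta>1 \<theta>2 \<phi>1 \<phi>2 l m (\<theta> j \<omega>) (\<phi> j \<omega>))))"
proof -
  have X: "Xs j \<omega> = sph (\<theta> j \<omega>) (\<phi> j \<omega>)" "\<theta> j \<omega> \<in> {0..pi}" if "j \<in> {1..n}" for j
    using assms(18)[OF that] by (auto simp: is_sph_coords_def)
  define a where "a l = (2 * real l + 1) / (4 * pi)" for l
  define c where "c l = a l * g (h * sqrt (real l * (real l + 1)))" for l
  define w where "w j l m = fact (l - m) / fact (l + m) * assoc_legendre l m (cos (\<theta> j \<omega>)) *
      (1 / real m * (sin (real m * (\<phi>2 - \<phi> j \<omega>)) - sin (real m * (\<phi>1 - \<phi> j \<omega>))))" for j l m
  define T0 where "T0 l = (\<Sum>k=0..l. real (l choose k) * real ((l + k) choose k) * (- 1 / 2) ^ k * (1 / (real k + 1)) *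
        ((1 - cos \<theta>2) ^ (k + 1) - (1 - cos \<theta>1) ^ (k + 1)))" for l
  define T where "T l m = (\<Sum>k=m..l. real (l choose k) * real ((l + k) choose k) * (2 * (- 1) ^ k * fact k / fact (k - m)) *
        B_diff m k (cos \<theta>2) (cos \<theta>1))" for l m
  \<comment> \<open>\<open>H x\<close> is the integral of the estimator along the parallel \<open>\<theta> = x\<close>; \<open>T0\<close> and \<open>T\<close> are the polar integrals.\<close>
  define H where "H x = 1 / real n * (\<Sum>j=1..n. \<Sum>l=0..N_trunc s r n. c l *
      ((\<phi>2 - \<phi>1) * (legendre_P l (cos x) * legendre_P l (cos (\<theta> j \<omega>))) +
       2 * (\<Sum>m=1..l. w j l m * assoc_legendre l m (cos x))))" for x
  have I_zero: "I_zero \<theta>1 \<theta>2 \<phi>1 \<phi>2 l (\<theta> j \<omega>) =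
      a l * ((\<phi>2 - \<phi>1) * legendre_P l (cos (\<theta> j \<omega>)) * T0 l)" for j l
    by (simp add: a_def I_zero_def N_norm_sq T0_def)
  have I_pos: "I_pos \<theta>1 \<theta>2 \<phi>1 \<phi>2 l m (\<theta> j \<omega>) (\<phi> j \<omega>) =
      a l * (w j l m * T l m)" for j l m
    by (simp add: a_def I_pos_def N_norm_sq w_def T_def mult_ac)
  let ?F = "f_hat s r g h n (\<lambda>j. Xs j \<omega>)"
  have F: "?F = (\<lambda>x. 1 / real n * (\<Sum>j=1..n. \<Sum>l=0..N_trunc s r n. c l * legendre_P l (x \<bullet> Xs j \<omega>)))"
    by (rule ext) (simp add: f_hat_def c_def a_def)
  have cont: "continuous_on UNIV ?F"
    unfolding F legendre_P_eq_poly by (intro continuous_intros)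
  have inner: "((\<lambda>y. ?F (sph x y)) has_integral H x) {\<phi>1..\<phi>2}" if "x \<in> {\<theta>1..\<theta>2}" for x
    unfolding F H_def
  proof (intro has_integral_mult_right has_integral_sum)
    fix j l assume j: "j \<in> {1..n}"
    show "((\<lambda>y. legendre_P l (sph x y \<bullet> Xs j \<omega>)) has_integral
        (\<phi>2 - \<phi>1) * (legendre_P l (cos x) * legendre_P l (cos (\<theta> j \<omega>))) +
        2 * (\<Sum>m=1..l. w j l m * assoc_legendre l m (cos x))) {\<phi>1..\<phi>2}"
      using has_integral_legendre_azimuth[of \<phi>1 \<phi>2 x "\<theta> j \<omega>" l "\<phi> j \<omega>"] that assms X[OF j]
      by (simp add: w_def mult_ac)
  qed auto
  have "((\<lambda>x. 1 / real n * (\<Sum>j=1..n. \<Sum>l=0..N_trunc s r n. c l *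
      ((\<phi>2 - \<phi>1) * legendre_P l (cos (\<theta> j \<omega>)) * (legendre_P l (cos x) * sin x) +
       2 * (\<Sum>m=1..l. w j l m * (assoc_legendre l m (cos x) * sin x))))) has_integral
    1 / real n * (\<Sum>j=1..n. \<Sum>l=0..N_trunc s r n. c l *
      ((\<phi>2 - \<phi>1) * legendre_P l (cos (\<theta> j \<omega>)) * T0 l +
       2 * (\<Sum>m=1..l. w j l m * T l m)))) {\<theta>1..\<theta>2}" (is "(?h has_integral ?V) _")
    unfolding T0_def T_def using assms
    by (intro has_integral_mult_right has_integral_sum has_integral_add
          has_integral_legendre_cos has_integral_assoc_legendre_cos) auto
  moreover have "?h = (\<lambda>x. H x * sin x)"
    by (rule ext) (simp add: H_def sum_distrib_left distrib_left mult_ac)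
  ultimately have outer: "((\<lambda>x. H x * sin x) has_integral ?V) {\<theta>1..\<theta>2}" by simp
  have "P_hat s r g h n (\<lambda>j. Xs j \<omega>) (region \<theta>1 \<theta>2 \<phi>1 \<phi>2) =
      integral {\<theta>1..\<theta>2} (\<lambda>x. integral {\<phi>1..\<phi>2} (\<lambda>y. ?F (sph x y)) * sin x)"
    unfolding P_hat_def using cont assms by (intro set_integral_sphere_region) auto
  also have "\<dots> = integral {\<theta>1..\<theta>2} (\<lambda>x. H x * sin x)"
    using integral_unique[OF inner] by (intro integral_cong) simp
  also have "\<dots> = ?V" using outer by (rule integral_unique)
  also have "\<dots> = 1 / real n * (\<Sum>j=1..n. \<Sum>l=0..N_trunc s r n.
      g (h * sqrt (real l * (real l + 1))) *
      (I_zero \<theta>1 \<theta>2 \<phi>1 \<phi>2 l (\<theta> j \<omega>) +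
       2 * (\<Sum>m=1..l. I_pos \<theta>1 \<theta>2 \<phi>1 \<phi>2 l m (\<theta> j \<omega>) (\<phi> j \<omega>))))"
    unfolding I_zero I_pos c_def by (simp add: distrib_left sum_distrib_left mult_ac)
  finally show ?thesis .
qed

end
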